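(* Let $\beta=\frac{1+\sqrt5}2$ and $0<p<1$. For $\nu_{\beta,p}$-a.e. $(\omega,x)\in\Omega\times[0,\beta]$ one has $$d\big(\nu_{\beta,p},(\omega,x)\big)=\frac{H(p)}{\log\beta}\Big(2-\nu_{\beta,p}(\Omega\times S)\Big)=\frac{H(p)}{\log\beta}\Big(2-\frac{p(1-p)}{p^2-p+1}\Big),$$ where $H(p)=-p\log p-(1-p)\log(1-p)$ and the local dimension is taken with respect to the metric $\rho$.
   Context: Let $\beta=\frac{1+\sqrt5}2$, $\Omega=\{0,1\}^{\mathbb N}$ with left shift $\sigma$, and partition $[0,\beta]$ into $E_0=[0,\frac1\beta)$, $S=[\frac1\beta,1]$, $E_1=(1,\beta]$. Let $T_0x=\beta x$, $T_1x=\beta x-1$. The random $\beta$-transformation $K:\Omega\times[0,\beta]\to\Omega\times[0,\beta]$ is $K(\omega,x)=(\omega,T_0x)$ if $x\in E_0$, $K(\omega,x)=(\omega,T_1x)$ if $x\in E_1$, and $K(\omega,x)=(\sigma\omega,T_{\omega_1}x)$ if $x\in S$. Digits: $b_1(\omega,x)=0$ if $x\in E_0$ or ($x\in S$ and $\omega_1=0$); $b_1(\omega,x)=1$ if $x\in E_1$ or ($x\in S$ and $\omega_1=1$); $b_n(\omega,x)=b_1(K^{n-1}(\omega,x))$; $\phi(\omega,x)=(b_n(\omega,x))_{n\ge1}\in\{0,1\}^{\mathbb N}$. Let $Z$ be the set of $(\omega,x)$ for which $K^n(\omega,x)\in\Omega\times S$ for infinitely many $n$; $\phi$ is a bimeasurable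 bijection from $Z$ onto its image. Let $m_p$ be the product measure on $\{0,1\}^{\mathbb N}$ with $m_p([0])=p$, $m_p([1])=1-p$, and $\nu_{\beta,p}=m_p\circ\phi$, i.e. $\nu_{\beta,p}(A)=m_p(\phi(A\cap Z))$, a $K$-invariant ergodic probability measure. Coding: $\alpha_j(\omega,x)=e_0,s,e_1$ according as $K^{j-1}(\omega,x)$ lies in $\Omega\times E_0$, $\Omega\times S$, $\Omega\times E_1$. Metric: for distinct points, $$\rho\big((\omega,x),(\omega',x')\big)=\beta^{-\min\{k\ge0:\ \omega_{k+1}\ne\omega'_{k+1}\text{ or }\alpha_{k+1}(\omega,x)\ne\alpha_{k+1}(\omega',x')\}}$$ (and $0$ for equal points). For a probability measure $\mu$ on a metric space, $d(\mu,z)=\lim_{r\downarrow0}\frac{\log\mu(B(z,r))}{\log r}$ when the limit exists, with $B(z,r)$ the open ball. *)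

theory Defs
  imports "HOL-Probability.Probability"
begin

section \<open>The random golden mean transformation\<close>

definition gm :: real where
  "gm = (1 + sqrt 5) / 2"

text \<open>Binary sequences are encoded as \<open>nat \<Rightarrow> bool\<close>, with \<open>True\<close> for the digit 1 and \<open>False\<close>
  for 0, and are indexed from 0: \<open>\<omega> n\<close> is the paper's \<open>\<omega>\<close> with subscript \<open>n + 1\<close>. The same
  shift by one applies to the digits and to the coding below.\<close>

type_synonym binseq = "nat \<Rightarrow> bool"

definition shift :: "binseq \<Rightarrow> binseq" where
  "shift \<omega> = (\<lambda>n. \<omega> (Suc n))"

definition E0 :: "real set" where "E0 = {0..<1 / gm}"
definition S :: "real set" where "S = {1 / gm..1}"
definition E1 :: "real set" where "E1 = {1<..gm}"

definition T :: "bool \<Rightarrow> real \<Rightarrow> real" where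
  "T d x = gm * x - of_bool d"

text \<open>\<open>E0\<close>, \<open>S\<close> and \<open>E1\<close> partition \<open>{0..gm}\<close>. The functions \<open>K\<close>, \<open>digit1\<close> and \<open>region_of\<close> are
  only meaningful for \<open>x\<close> in that interval, and their values elsewhere are never used.\<close>

definition K :: "binseq \<times> real \<Rightarrow> binseq \<times> real" where
  "K = (\<lambda>(\<omega>, x).
     if x \<in> E0 then (\<omega>, T False x)
     else if x \<in> S then (shift \<omega>, T (\<omega> 0) x)
     else (\<omega>, T True x))"

definition digit1 :: "binseq \<times> real \<Rightarrow> bool" where
  "digit1 = (\<lambda>(\<omega>, x). x \<in> E1 \<or> x \<in> S \<and> \<omega> 0)"

definition \<phi> :: "binseq \<times> real \<Rightarrow> binseq" where
  "\<phi> z = (\<lambda>n. digit1 ((K ^^ n) z))"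

definition Z :: "(binseq \<times> real) set" where
  "Z = {z \<in> UNIV \<times> {0..gm}. infinite {n. (K ^^ n) z \<in> UNIV \<times> S}}"

section \<open>The measures\<close>

definition m :: "real \<Rightarrow> binseq measure" where
  "m p = PiM UNIV (\<lambda>_. measure_pmf (bernoulli_pmf (1 - p)))"

definition phase_space :: "(binseq \<times> real) measure" where
  "phase_space = PiM UNIV (\<lambda>_. count_space UNIV) \<Otimes>\<^sub>M restrict_space borel {0..gm}"

text \<open>\<open>\<phi>\<close> is injective on \<open>Z\<close> and maps measurable subsets of \<open>Z\<close> to measurable sets, so the set
  function below is countably additive and \<open>emeasure (\<nu> p)\<close> agrees with it.\<close>

definition \<nu> :: "real \<Rightarrow> (binseq \<times> real) measure" where
  "\<nu> p = measure_of (space phase_space) (sets phase_space) (\<lambda>A. emeasure (m p) (\<phi> ` (A \<inter> Z)))"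

definition H :: "real \<Rightarrow> real" where
  "H p = - p * ln p - (1 - p) * ln (1 - p)"

section \<open>The metric\<close>

datatype region = R_e0 | R_s | R_e1

definition region_of :: "binseq \<times> real \<Rightarrow> region" where
  "region_of = (\<lambda>(\<omega>, x). if x \<in> E0 then R_e0 else if x \<in> S then R_s else R_e1)"

definition \<alpha> :: "binseq \<times> real \<Rightarrow> nat \<Rightarrow> region" where
  "\<alpha> z n = region_of ((K ^^ n) z)"

definition \<rho> :: "binseq \<times> real \<Rightarrow> binseq \<times> real \<Rightarrow> real" where
  "\<rho> z z' = (if z = z' then 0
     else (1 / gm) ^ (LEAST k. fst z k \<noteq> fst z' k \<or> \<alpha> z k \<noteq> \<alpha> z' k))"

text \<open>\<open>has_local_dim M d z D\<close>: the local dimension of \<open>M\<close> at \<open>z\<close>, with respect to the metric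
  \<open>d\<close> on \<open>space M\<close>, exists and equals the real number \<open>D\<close>. The positivity condition is there
  because \<open>ln 0 = 0\<close> here: a null ball means that the local dimension is infinite.\<close>

definition has_local_dim :: "'a measure \<Rightarrow> ('a \<Rightarrow> 'a \<Rightarrow> real) \<Rightarrow> 'a \<Rightarrow> real \<Rightarrow> bool" where
  "has_local_dim M d z D \<longleftrightarrow>
     (\<forall>r>0. measure M (Metric_space.mball (space M) d z r) > 0) \<and>
     ((\<lambda>r. ln (measure M (Metric_space.mball (space M) d z r)) / ln r) \<longlongrightarrow> D) (at_right 0)"

text \<open>\<open>\<rho>\<close> is a metric on the phase space, so the balls in \<open>has_local_dim\<close> are the usual ones.\<close>

lemma gm_gt_1: "gm > 1"
  unfolding gm_def by (simp add: real_less_rsqrt)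

lemma gm_square: "gm * gm = gm + 1"
  unfolding gm_def by (simp add: field_simps)

lemma space_phase_space: "space phase_space = UNIV \<times> {0..gm}"
  by (auto simp: phase_space_def space_pair_measure space_PiM space_restrict_space)

lemma space_nu: "space (\<nu> p) = UNIV \<times> {0..gm}"
  using sets.space_closed[of phase_space]
  by (simp add: \<nu>_def space_measure_of space_phase_space)

lemma K_in_space:
  assumes "z \<in> UNIV \<times> {0..gm}"
  shows "K z \<in> UNIV \<times> {0..gm}"
proof -
  obtain \<omega> x where z: "z = (\<omega>, x)" "0 \<le> x" "x \<le> gm" using assms by auto
  have "gm * x \<le> gm + 1"
    using mult_left_mono[OF z(3), of gm] gm_gt_1 gm_square by simp
  moreover have "gm * x \<ge> 1" if "x \<ge> 1 / gm"
    using that gm_gt_1 by (simp add: field_simps)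
  moreover have "gm * x \<le> gm" if "x \<le> 1"
    using that gm_gt_1 by simp
  moreover have "x \<le> 1" if "x < 1 / gm"
  proof -
    have "1 / gm \<le> 1" using gm_gt_1 by simp
    with that show ?thesis by linarith
  qed
  ultimately show ?thesis
    using z gm_gt_1 by (auto simp: K_def T_def E0_def S_def)
qed

lemma coding_separates:
  assumes z: "z \<in> UNIV \<times> {0..gm}" and z': "z' \<in> UNIV \<times> {0..gm}"
    and eq: "fst z = fst z'" "\<And>k. \<alpha> z k = \<alpha> z' k"
  shows "z = z'"
proof (rule ccontr)
  assume "z \<noteq> z'"
  then have ne: "\<bar>snd z - snd z'\<bar> > 0" using eq(1) by (auto simp: prod_eq_iff)
  have step: "fst ((K ^^ n) z) = fst ((K ^^ n) z') \<and>
      snd ((K ^^ n) z) - snd ((K ^^ n) z') = gm ^ n * (snd z - snd z')" for n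
  proof (induction n)
    case (Suc n)
    obtain \<omega> x \<omega>' x' where K: "(K ^^ n) z = (\<omega>, x)" "(K ^^ n) z' = (\<omega>', x')"
      by (meson surj_pair)
    have "region_of (\<omega>, x) = region_of (\<omega>', x')"
      using eq(2)[of n] K by (simp add: \<alpha>_def)
    moreover have "\<omega> = \<omega>'" "x - x' = gm ^ n * (snd z - snd z')" using Suc K by auto
    ultimately have "fst (K (\<omega>, x)) = fst (K (\<omega>', x'))"
      and "snd (K (\<omega>, x)) - snd (K (\<omega>', x')) = gm * (x - x')"
      by (auto simp: region_of_def K_def T_def algebra_simps split: if_splits)
    with \<open>x - x' = _\<close> K show ?case by (simp add: mult.assoc)
  qed (simp add: eq(1))
  have orbit: "(K ^^ n) y \<in> UNIV \<times> {0..gm}" if "y \<in> UNIV \<times> {0..gm}" for y n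
    using that K_in_space by (induction n) auto
  have bound: "gm ^ n * \<bar>snd z - snd z'\<bar> \<le> gm" for n
  proof -
    have "\<bar>snd ((K ^^ n) z) - snd ((K ^^ n) z')\<bar> \<le> gm"
      using orbit[OF z, of n] orbit[OF z', of n] by auto
    then show ?thesis using step[of n] gm_gt_1 by (simp add: abs_mult)
  qed
  obtain n where "gm / \<bar>snd z - snd z'\<bar> < gm ^ n"
    using real_arch_pow[OF gm_gt_1] by blast
  then show False using bound[of n] ne by (simp add: field_simps)
qed

lemma Metric_space_rho: "Metric_space (UNIV \<times> {0..gm}) \<rho>"
proof
  define P where "P y z k \<longleftrightarrow> fst y k \<noteq> fst z k \<or> \<alpha> y k \<noteq> \<alpha> z k" for y z k
  have rho: "\<rho> y z = (if y = z then 0 else (1 / gm) ^ (LEAST k. P y z k))" for y z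
    by (simp add: \<rho>_def P_def)
  show nonneg: "0 \<le> \<rho> y z" for y z using gm_gt_1 by (simp add: \<rho>_def)
  show "\<rho> y z = \<rho> z y" for y z
    unfolding \<rho>_def by (simp add: eq_commute)
  show "\<rho> y z = 0 \<longleftrightarrow> y = z" for y z
    using gm_gt_1 by (simp add: \<rho>_def)
  show "\<rho> x z \<le> \<rho> x y + \<rho> y z"
    if mem: "x \<in> UNIV \<times> {0..gm}" "y \<in> UNIV \<times> {0..gm}" "z \<in> UNIV \<times> {0..gm}" for x y z
  proof (cases "x = z")
    case True
    then show ?thesis using nonneg by (simp add: rho)
  next
    case False
    define k where "k = (LEAST k. P x z k)"
    have "\<exists>k. P x z k"
      using False coding_separates[OF mem(1) mem(3)] by (auto simp: P_def fun_eq_iff)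
    then have "P x z k" unfolding k_def by (rule LeastI_ex)
    then have "P x y k \<or> P y z k" by (auto simp: P_def)
    moreover have le: "(1 / gm) ^ k \<le> \<rho> u v" if "P u v k" for u v
    proof -
      have "u \<noteq> v" using that by (auto simp: P_def)
      moreover have "(LEAST k. P u v k) \<le> k" using that by (rule Least_le)
      ultimately show ?thesis using gm_gt_1 by (simp add: rho power_decreasing)
    qed
    ultimately have "(1 / gm) ^ k \<le> \<rho> x y \<or> (1 / gm) ^ k \<le> \<rho> y z" by blast
    then show ?thesis
      using nonneg[of x y] nonneg[of y z] False by (auto simp: rho[of x z] k_def)
  qed
qed

end

theory Submission
  imports Defs "HOL-Library.Discrete_Functions"
begin

text \<open>
  On all of the sequence space, \<open>\<phi>\<close> has the right inverse \<open>\<psi>\<close> that reads off the point \<open>val b\<close> with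
  digits \<open>b\<close> together with the digits chosen at the visits to \<open>S\<close>, and \<open>\<psi>\<close> conjugates the shift to
  \<open>K\<close>. Hence \<open>\<nu> p\<close> is the image of the Bernoulli measure under \<open>\<psi>\<close>.

  Since \<open>gm * gm = gm + 1\<close>, the region of \<open>b\<close> is almost surely a function of the first digit of \<open>b\<close>
  and the region of its shift. It follows that the three regions have explicit probabilities and that
  the digits chosen at the visits to \<open>S\<close> are i.i.d. with the weights \<open>p\<close> and \<open>1 - p\<close> interchanged,
  independently of the first region. A ball of radius about \<open>gm\<close> to the power \<open>- n\<close> therefore has as
  its measure, up to a bounded factor, the product of the weights of the first \<open>n\<close> digits and of the
  weights of those of the first \<open>n\<close> choices that are not yet used up at time \<open>n\<close>. The fraction of
  used choices tends to the measure of \<open>S\<close>, so the strong law of large numbers gives the exponent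
  \<open>H p + H p * (1 - \<nu> p (UNIV \<times> S))\<close>.
\<close>

section \<open>A strong law for bounded orthogonal variables\<close>

text \<open>For \<open>n\<close> between \<open>k^2\<close> and \<open>(k+1)^2\<close> the sum
  differs from the one at \<open>k^2\<close> by at most \<open>2 * k * C\<close>, so the average
  changes by at most \<open>2 * C / k\<close>.\<close>

lemma averages_tendsto_zero_from_squares:
  fixes x :: "nat \<Rightarrow> real"
  assumes bound: "\<And>i. \<bar>x i\<bar> \<le> C"
    and lim: "(\<lambda>k. (\<Sum>i<k\<^sup>2. x i) / real (k\<^sup>2)) \<longlonglongrightarrow> 0"
  shows "(\<lambda>n. (\<Sum>i<n. x i) / real n) \<longlonglongrightarrow> 0"
proof -
  define A where "A k = \<bar>(\<Sum>i<k\<^sup>2. x i) / real (k\<^sup>2)\<bar> + 2 * C / real k" for k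
  have "C \<ge> 0" using bound[of 0] by simp
  have le: "\<bar>(\<Sum>i<n. x i) / real n\<bar> \<le> A (floor_sqrt n)" if "n > 0" for n
  proof -
    define k where "k = floor_sqrt n"
    have k: "k > 0" "k\<^sup>2 \<le> n" "n < (Suc k)\<^sup>2"
      using that by (auto simp: k_def Suc_floor_sqrt_power2_gt)
    have "(\<Sum>i<n. x i) = (\<Sum>i<k\<^sup>2. x i) + (\<Sum>i\<in>{k\<^sup>2..<n}. x i)"
      using k(2) by (metis atLeast0LessThan sum.atLeastLessThan_concat zero_le)
    moreover have "\<bar>\<Sum>i\<in>{k\<^sup>2..<n}. x i\<bar> \<le> (\<Sum>i\<in>{k\<^sup>2..<n}. C)"
      by (rule order_trans[OF sum_abs sum_mono]) (use bound in auto)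
    moreover have "(\<Sum>i\<in>{k\<^sup>2..<n}. C) \<le> 2 * real k * C"
    proof -
      have "n - k\<^sup>2 \<le> 2 * k" using k by (simp add: power2_eq_square)
      then have "real (n - k\<^sup>2) \<le> 2 * real k" by linarith
      then show ?thesis using \<open>C \<ge> 0\<close> by (simp add: mult_right_mono)
    qed
    ultimately have *: "\<bar>\<Sum>i<n. x i\<bar> \<le> \<bar>\<Sum>i<k\<^sup>2. x i\<bar> + 2 * real k * C" by linarith
    have "real (k\<^sup>2) \<le> real n" using k(2) by (rule of_nat_mono)
    then have "\<bar>\<Sum>i<n. x i\<bar> / real n \<le> (\<bar>\<Sum>i<k\<^sup>2. x i\<bar> + 2 * real k * C) / real (k\<^sup>2)"
      using * k \<open>C \<ge> 0\<close> by (intro frac_le) auto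
    also have "\<dots> = A k"
      using k(1) by (simp add: A_def field_simps power2_eq_square)
    finally show ?thesis by (simp add: k_def)
  qed
  have "A \<longlonglongrightarrow> \<bar>0\<bar> + 0"
    unfolding A_def by (intro tendsto_add tendsto_rabs lim lim_const_over_n)
  moreover have "filterlim floor_sqrt at_top sequentially"
    unfolding filterlim_at_top
  proof
    fix N :: nat
    show "\<forall>\<^sub>F n in sequentially. N \<le> floor_sqrt n"
      using eventually_ge_at_top[of "N\<^sup>2"] by eventually_elim (rule le_floor_sqrtI)
  qed
  ultimately have "(\<lambda>n. A (floor_sqrt n)) \<longlonglongrightarrow> 0"
    by (simp add: filterlim_compose)
  then show ?thesis
    by (rule Lim_null_comparison[rotated])
       (use eventually_gt_at_top[of "0::nat"] in \<open>eventually_elim; use le in auto\<close>)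
qed

text \<open>By orthogonality only the diagonal terms survive in the second moment of a sum, so the
  average of \<open>n\<close> variables has second moment at most \<open>C^2 / n\<close>. Along
  squares these bounds are summable, and boundedness fills the gaps between the squares.\<close>

lemma (in prob_space) orthogonal_strong_law:
  fixes X :: "nat \<Rightarrow> 'a \<Rightarrow> real"
  assumes X[measurable]: "\<And>i. X i \<in> borel_measurable M"
    and bound: "\<And>i x. \<bar>X i x\<bar> \<le> C"
    and orth: "\<And>i j. i < j \<Longrightarrow> expectation (\<lambda>x. X i x * X j x) = 0"
  shows "AE x in M. (\<lambda>n. (\<Sum>i<n. X i x) / real n) \<longlonglongrightarrow> 0"
proof -
  have "C \<ge> 0" using bound[of 0 undefined] by linarith
  have b2: "\<bar>X i x * X j x\<bar> \<le> C\<^sup>2" for i j x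
    unfolding abs_mult power2_eq_square using bound \<open>C \<ge> 0\<close> by (intro mult_mono) auto
  have int: "integrable M (\<lambda>x. X i x * X j x)" for i j
    by (rule integrable_const_bound[where B="C\<^sup>2"]) (use b2 in auto)
  have sq: "expectation (\<lambda>x. (\<Sum>i<n. X i x)\<^sup>2) \<le> real n * C\<^sup>2" for n
  proof -
    have "expectation (\<lambda>x. (\<Sum>i<n. X i x)\<^sup>2) = (\<Sum>i<n. \<Sum>j<n. expectation (\<lambda>x. X i x * X j x))"
      unfolding power2_eq_square sum_product using int by (subst Bochner_Integration.integral_sum; simp)+
    also have "\<dots> = (\<Sum>i<n. \<Sum>j<n. if i = j then expectation (\<lambda>x. X i x * X i x) else 0)"
    proof (intro sum.cong refl)
      fix i j
      show "expectation (\<lambda>x. X i x * X j x) = (if i = j then expectation (\<lambda>x. X i x * X i x) else 0)"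
        using orth[of i j] orth[of j i] by (cases i j rule: linorder_cases) (auto simp: mult.commute)
    qed
    also have "\<dots> = (\<Sum>i<n. expectation (\<lambda>x. X i x * X i x))" by simp
    also have "\<dots> \<le> (\<Sum>i<n. C\<^sup>2)"
    proof (intro sum_mono)
      fix i
      have "expectation (\<lambda>x. X i x * X i x) \<le> expectation (\<lambda>_. C\<^sup>2)"
        using int[of i i] b2[of i _ i] by (intro integral_mono) (auto simp: abs_le_iff)
      then show "expectation (\<lambda>x. X i x * X i x) \<le> C\<^sup>2" by (simp add: prob_space)
    qed
    finally show ?thesis by simp
  qed
  \<comment> \<open>\<open>Suc k\<close> keeps the divisor positive. The expected sum of all
    \<open>f k\<close> is finite, so the series converges almost surely and its terms tend to
    0.\<close>
  define f where "f k x = ((\<Sum>i<(Suc k)\<^sup>2. X i x) / real ((Suc k)\<^sup>2))\<^sup>2" for k x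
  have [measurable]: "f k \<in> borel_measurable M" for k unfolding f_def by measurable
  have fle: "(\<integral>\<^sup>+x. ennreal (f k x) \<partial>M) \<le> ennreal (C\<^sup>2 * inverse (real ((Suc k)\<^sup>2)))" for k
  proof -
    have "\<bar>\<Sum>i<n. X i x\<bar> \<le> real n * C" for n x
      using order_trans[OF sum_abs sum_mono[of "{..<n}" "\<lambda>i. \<bar>X i x\<bar>" "\<lambda>_. C"]] bound by simp
    then have "(\<Sum>i<n. X i x)\<^sup>2 \<le> (real n * C)\<^sup>2" for n x
      by (metis abs_ge_zero power2_abs power_mono)
    then have "integrable M (\<lambda>x. (\<Sum>i<n. X i x)\<^sup>2)" for n
      by (intro integrable_const_bound[where B="(real n * C)\<^sup>2"]) auto
    then have "integrable M (f k)" unfolding f_def power_divide by simp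
    then have "(\<integral>\<^sup>+x. ennreal (f k x) \<partial>M) = ennreal (expectation (f k))"
      by (rule nn_integral_eq_integral) (simp add: f_def)
    also have "expectation (f k) \<le> real ((Suc k)\<^sup>2) * C\<^sup>2 / (real ((Suc k)\<^sup>2))\<^sup>2"
      unfolding f_def power_divide integral_divide_zero using sq[of "(Suc k)\<^sup>2"]
      by (intro divide_right_mono) auto
    also have "\<dots> = C\<^sup>2 * inverse (real ((Suc k)\<^sup>2))"
      by (simp add: power2_eq_square field_simps del: of_nat_Suc)
    finally show ?thesis by (simp add: ennreal_leI)
  qed
  have summ: "summable (\<lambda>k. C\<^sup>2 * inverse (real ((Suc k)\<^sup>2)))"
    using inverse_power_summable[of 2, where 'a=real] summable_Suc_iff[of "\<lambda>k. inverse (real (k\<^sup>2))"]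
    by (intro summable_mult) simp
  have "(\<integral>\<^sup>+x. (\<Sum>k. ennreal (f k x)) \<partial>M) = (\<Sum>k. \<integral>\<^sup>+x. ennreal (f k x) \<partial>M)"
    by (intro nn_integral_suminf) auto
  also have "\<dots> \<le> (\<Sum>k. ennreal (C\<^sup>2 * inverse (real ((Suc k)\<^sup>2))))"
    by (intro suminf_le fle) auto
  also have "\<dots> = ennreal (\<Sum>k. C\<^sup>2 * inverse (real ((Suc k)\<^sup>2)))"
    using summ by (intro suminf_ennreal2) auto
  finally have "(\<integral>\<^sup>+x. (\<Sum>k. ennreal (f k x)) \<partial>M) \<noteq> \<infinity>"
    by (metis ennreal_less_top infinity_ennreal_def neq_top_trans order_less_imp_not_eq)
  then have "AE x in M. (\<Sum>k. ennreal (f k x)) \<noteq> \<infinity>"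
    by (intro nn_integral_PInf_AE) auto
  then show ?thesis
  proof eventually_elim
    case (elim x)
    have "summable (\<lambda>k. f k x)"
      using elim by (intro summable_suminf_not_top) (auto simp: f_def)
    then have "(\<lambda>k. f k x) \<longlonglongrightarrow> 0" by (rule summable_LIMSEQ_zero)
    then have "(\<lambda>k. sqrt (f k x)) \<longlonglongrightarrow> sqrt 0" by (rule tendsto_real_sqrt)
    then have "(\<lambda>k. (\<Sum>i<(Suc k)\<^sup>2. X i x) / real ((Suc k)\<^sup>2)) \<longlonglongrightarrow> 0"
      unfolding f_def real_sqrt_abs real_sqrt_zero by (rule tendsto_rabs_zero_cancel)
    then have "(\<lambda>k. (\<Sum>i<k\<^sup>2. X i x) / real (k\<^sup>2)) \<longlonglongrightarrow> 0"
      by (rule LIMSEQ_imp_Suc)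
    then show ?case using bound by (intro averages_tendsto_zero_from_squares) auto
  qed
qed

section \<open>The inverse of the digit map\<close>

abbreviation bitseq_space :: "binseq measure" where
  "bitseq_space \<equiv> PiM UNIV (\<lambda>_. count_space UNIV)"

definition val :: "binseq \<Rightarrow> real" where
  "val b = (\<Sum>n. of_bool (b n) / gm ^ Suc n)"

text \<open>\<open>region_of\<close> inspects only the second component, so the \<open>b\<close> in
  the pair is a dummy.\<close>

definition creg :: "binseq \<Rightarrow> region" where
  "creg b = region_of (b, val b)"

text \<open>Time \<open>n\<close> itself is excluded: a visit to \<open>S\<close> at time
  \<open>n\<close> then uses the choice with index \<open>visits b n\<close>.\<close>

definition visits :: "binseq \<Rightarrow> nat \<Rightarrow> nat" where
  "visits b n = card {i. i < n \<and> creg ((shift ^^ i) b) = R_s}"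

text \<open>If there are only \<open>k\<close> visits to \<open>S\<close>, then \<open>choices b\<close> is \<open>False\<close> from \<open>k\<close> on.\<close>
definition choices :: "binseq \<Rightarrow> binseq" where
  "choices b = (\<lambda>j. \<exists>n. creg ((shift ^^ n) b) = R_s \<and> visits b n = j \<and> b n)"

definition \<psi> :: "binseq \<Rightarrow> binseq \<times> real" where
  "\<psi> b = (choices b, val b)"

section \<open>Expansions in base \<open>gm\<close>, regions and visits\<close>

lemma gm_pos [simp]: "gm > 0" "gm \<ge> 0" "gm \<noteq> 0"
  using gm_gt_1 by auto

lemma inverse_gm: "1 / gm = gm - 1"
  using gm_square by (simp add: field_simps)

lemma less_inverse_gm: "x < 1 / gm \<Longrightarrow> x < 1"
  using gm_gt_1 by (simp add: field_simps) (smt (verit) mult_less_cancel_left2)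

lemma shift_funpow: "(shift ^^ n) b = (\<lambda>i. b (n + i))"
  by (induction n arbitrary: b) (auto simp: shift_def)

lemma shift_case_nat [simp]: "shift (case_nat d b) = b"
  by (simp add: shift_def)

lemma case_nat_shift: "case_nat (b 0) (shift b) = b"
  by (auto simp: shift_def fun_eq_iff split: nat.split)

text \<open>The series sums to \<open>1 / (gm - 1)\<close>, which is \<open>gm\<close> by
  \<open>gm_square\<close>; this keeps \<open>val\<close> inside the phase interval.\<close>

lemma sums_geometric_gm: "(\<lambda>n. 1 / gm ^ Suc n) sums gm"
proof -
  have "(\<lambda>n. (1 / gm) * (1 / gm) ^ n) sums ((1 / gm) * (1 / (1 - 1 / gm)))"
    using gm_gt_1 by (intro sums_mult geometric_sums) simp
  moreover have "(1 / gm) * (1 / (1 - 1 / gm)) = gm"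
    using gm_gt_1 gm_square by (simp add: field_simps)
  ultimately show ?thesis by (simp add: power_one_over)
qed

lemma summable_val: "summable (\<lambda>n. of_bool (b n) / gm ^ Suc n)"
  by (rule summable_comparison_test'[OF sums_summable[OF sums_geometric_gm]])
     (auto simp: divide_right_mono)

lemma val_nonneg: "0 \<le> val b"
  unfolding val_def by (intro suminf_nonneg summable_val) simp

lemma val_le: "val b \<le> gm"
proof -
  have "val b \<le> (\<Sum>n. 1 / gm ^ Suc n)"
    unfolding val_def
    by (intro suminf_le summable_val sums_summable[OF sums_geometric_gm]) (simp add: divide_right_mono)
  then show ?thesis using sums_unique[OF sums_geometric_gm] by simp
qed

lemma val_rec: "val b = (of_bool (b 0) + val (shift b)) / gm"
proof -
  have "val b = of_bool (b 0) / gm + (\<Sum>n. of_bool (b (Suc n)) / gm ^ Suc (Suc n))"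
    unfolding val_def using suminf_split_initial_segment[OF summable_val, where k=1] by simp
  also have "(\<Sum>n. of_bool (b (Suc n)) / gm ^ Suc (Suc n)) = (\<Sum>n. (of_bool (shift b n) / gm ^ Suc n) / gm)"
    by (simp add: shift_def field_simps)
  also have "\<dots> = val (shift b) / gm"
    unfolding val_def by (rule suminf_divide[OF summable_val])
  finally show ?thesis by (simp add: add_divide_distrib)
qed

lemma val_case_nat: "val (case_nat d b) = (of_bool d + val b) / gm"
  using val_rec[of "case_nat d b"] by simp

lemma val_ge_if_True: "b 0 \<Longrightarrow> val b \<ge> 1 / gm"
  using val_nonneg[of "shift b"] by (subst val_rec) (simp add: divide_right_mono)

lemma val_le_if_False: "\<not> b 0 \<Longrightarrow> val b \<le> 1"
  using val_le[of "shift b"] by (subst val_rec) simp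

lemma creg_iff:
  "creg b = R_e0 \<longleftrightarrow> val b < 1 / gm"
  "creg b = R_s \<longleftrightarrow> 1 / gm \<le> val b \<and> val b \<le> 1"
  "creg b = R_e1 \<longleftrightarrow> 1 < val b"
proof -
  show "creg b = R_e0 \<longleftrightarrow> val b < 1 / gm"
    "creg b = R_s \<longleftrightarrow> 1 / gm \<le> val b \<and> val b \<le> 1"
    "creg b = R_e1 \<longleftrightarrow> 1 < val b"
    using val_nonneg[of b]
    by (auto simp: creg_def region_of_def E0_def S_def dest: less_inverse_gm)
qed

lemma visits_0 [simp]: "visits b 0 = 0"
  by (simp add: visits_def)

lemma visits_Suc: "visits b (Suc n) = visits b n + of_bool (creg ((shift ^^ n) b) = R_s)"
proof -
  have "{i. i < Suc n \<and> creg ((shift ^^ i) b) = R_s} =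
    {i. i < n \<and> creg ((shift ^^ i) b) = R_s} \<union> (if creg ((shift ^^ n) b) = R_s then {n} else {})"
    by (auto simp: less_Suc_eq)
  then show ?thesis by (auto simp: visits_def)
qed

lemma visits_le: "visits b n \<le> n"
  by (induction n) (auto simp: visits_Suc)

text \<open>Counterpart of \<open>visits_Suc\<close> that splits off the first time instead of the
  last, for arguments that prepend a digit.\<close>

lemma visits_Suc_shift: "visits b (Suc n) = of_bool (creg b = R_s) + visits (shift b) n"
  by (induction n) (simp_all add: visits_Suc del: funpow.simps add: funpow_0 funpow_Suc_right)

lemma ex_nat_split: "(\<exists>n. P n) \<longleftrightarrow> P 0 \<or> (\<exists>n. P (Suc n))"
  by (metis not0_implies_Suc)

text \<open>An initial visit to \<open>S\<close> records the first digit and raises the index of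
  every later choice by one; any other start leaves the choices of the tail as they are.\<close>

lemma choices_rec:
  "choices b = (if creg b = R_s then case_nat (b 0) (choices (shift b)) else choices (shift b))"
proof
  fix j
  have *: "choices b j \<longleftrightarrow> creg b = R_s \<and> j = 0 \<and> b 0 \<or> 
    (\<exists>n. creg ((shift ^^ n) (shift b)) = R_s \<and> of_bool (creg b = R_s) + visits (shift b) n = j \<and> shift b n)"
    unfolding choices_def
    by (subst ex_nat_split) (auto simp: visits_Suc_shift funpow_Suc_right shift_def simp del: funpow.simps)
  show "choices b j = (if creg b = R_s then case_nat (b 0) (choices (shift b)) else choices (shift b)) j"
    unfolding * by (cases j) (auto simp: choices_def)
qed

section \<open>Conjugacy of the shift with \<open>K\<close>\<close>

lemma fst_\<psi>: "fst (\<psi> b) = choices b"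
  by (simp add: \<psi>_def)

lemma \<psi>_in_space: "\<psi> b \<in> UNIV \<times> {0..gm}"
  by (simp add: \<psi>_def val_nonneg val_le)

lemma region_of_\<psi>: "region_of (\<psi> b) = creg b"
  by (simp add: \<psi>_def creg_def region_of_def)

lemma \<psi>_in_S_iff: "\<psi> b \<in> UNIV \<times> S \<longleftrightarrow> creg b = R_s"
  unfolding creg_iff by (simp add: \<psi>_def S_def)

text \<open>Outside \<open>S\<close> the first digit is forced: a digit 1 makes the value at least
  \<open>1 / gm\<close>, a digit 0 makes it at most 1. Inside \<open>S\<close> the map
  \<open>K\<close> reads the leading choice, which is the first digit by
  \<open>choices_rec\<close>.\<close>

lemma K_\<psi>: "K (\<psi> b) = \<psi> (shift b)"
proof -
  have v: "gm * val b = of_bool (b 0) + val (shift b)" by (subst val_rec) simp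
  have E0: "val b \<in> E0 \<longleftrightarrow> creg b = R_e0" and S: "val b \<in> S \<longleftrightarrow> creg b = R_s"
    unfolding creg_iff by (auto simp: E0_def S_def val_nonneg)
  show ?thesis
  proof (cases "creg b")
    case R_e0
    then have "\<not> b 0" using val_ge_if_True[of b] by (auto simp: creg_iff)
    then show ?thesis using R_e0 E0 v by (auto simp: K_def \<psi>_def T_def choices_rec[of b])
  next
    case R_s
    then show ?thesis using E0 S v
      by (simp add: K_def \<psi>_def T_def choices_rec[of b])
  next
    case R_e1
    then have "b 0" using val_le_if_False[of b] by (auto simp: creg_iff)
    then show ?thesis using R_e1 E0 S v by (auto simp: K_def \<psi>_def T_def choices_rec[of b])
  qed
qed

lemma K_funpow_\<psi>: "(K ^^ n) (\<psi> b) = \<psi> ((shift ^^ n) b)"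
  by (induction n) (simp_all add: K_\<psi>)

lemma \<alpha>_\<psi>: "\<alpha> (\<psi> b) n = creg ((shift ^^ n) b)"
  by (simp add: \<alpha>_def K_funpow_\<psi> region_of_\<psi>)

lemma digit1_\<psi>: "digit1 (\<psi> b) = b 0"
proof -
  have "val b \<in> E1 \<longleftrightarrow> creg b = R_e1" and "val b \<in> S \<longleftrightarrow> creg b = R_s"
    unfolding creg_iff by (auto simp: E1_def S_def val_le)
  then show ?thesis
    using val_ge_if_True[of b] val_le_if_False[of b]
    by (cases "creg b") (auto simp: digit1_def \<psi>_def choices_rec[of b] creg_iff)
qed

lemma \<phi>_\<psi>: "\<phi> (\<psi> b) = b"
  by (simp add: \<phi>_def K_funpow_\<psi> digit1_\<psi> shift_funpow)

lemma \<psi>_in_Z_iff: "\<psi> b \<in> Z \<longleftrightarrow> infinite {n. creg ((shift ^^ n) b) = R_s}"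
  using \<psi>_in_space[of b] by (simp add: Z_def K_funpow_\<psi> \<psi>_in_S_iff)

section \<open>Recovering a point from its digits\<close>

lemma K_funpow_in_space: "z \<in> UNIV \<times> {0..gm} \<Longrightarrow> (K ^^ n) z \<in> UNIV \<times> {0..gm}"
  by (induction n) (simp_all add: K_in_space)

lemma \<phi>_K_funpow: "\<phi> ((K ^^ n) z) = (shift ^^ n) (\<phi> z)"
  by (simp add: \<phi>_def shift_funpow funpow_add add.commute)

lemma snd_K: "z \<in> UNIV \<times> {0..gm} \<Longrightarrow> snd (K z) = gm * snd z - of_bool (digit1 z)"
  by (cases z) (auto simp: K_def digit1_def T_def E0_def E1_def S_def dest: less_inverse_gm)

text \<open>Each step of \<open>K\<close> multiplies the difference of the two sides by
  \<open>gm\<close>, while both sides stay in an interval of length \<open>gm\<close>; so the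
  difference is 0.\<close>

lemma val_\<phi>:
  assumes z: "z \<in> UNIV \<times> {0..gm}"
  shows "val (\<phi> z) = snd z"
proof -
  have step: "snd z - val (\<phi> z) = (snd (K z) - val (\<phi> (K z))) / gm" if "z \<in> UNIV \<times> {0..gm}" for z
  proof -
    have "\<phi> z 0 = digit1 z" "\<phi> (K z) = shift (\<phi> z)"
      using \<phi>_K_funpow[of 1 z] by (simp_all add: \<phi>_def)
    then have "gm * val (\<phi> z) = of_bool (digit1 z) + val (\<phi> (K z))"
      by (subst val_rec) simp
    then have "gm * (snd z - val (\<phi> z)) = snd (K z) - val (\<phi> (K z))"
      using snd_K[OF that] unfolding right_diff_distrib by linarith
    then show ?thesis by (simp add: field_simps)
  qed
  have eq: "gm ^ n * (snd z - val (\<phi> z)) = snd ((K ^^ n) z) - val (\<phi> ((K ^^ n) z))" for n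
  proof (induction n)
    case (Suc n)
    have "gm ^ Suc n * (snd z - val (\<phi> z)) = gm * (snd ((K ^^ n) z) - val (\<phi> ((K ^^ n) z)))"
      using Suc by simp
    also have "\<dots> = snd ((K ^^ Suc n) z) - val (\<phi> ((K ^^ Suc n) z))"
      by (subst step[OF K_funpow_in_space[OF z]]) simp
    finally show ?case .
  qed simp
  have "\<bar>snd ((K ^^ n) z) - val (\<phi> ((K ^^ n) z))\<bar> \<le> gm" for n
  proof -
    have "0 \<le> snd ((K ^^ n) z)" "snd ((K ^^ n) z) \<le> gm"
      using K_funpow_in_space[OF z, of n] by (auto simp: mem_Times_iff)
    then show ?thesis
      using val_nonneg[of "\<phi> ((K ^^ n) z)"] val_le[of "\<phi> ((K ^^ n) z)"] by linarith
  qed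
  then have bd: "gm ^ n * \<bar>snd z - val (\<phi> z)\<bar> \<le> gm" for n
    by (metis abs_mult abs_of_pos eq gm_pos(1) zero_less_power)
  show ?thesis
  proof (rule ccontr)
    assume "val (\<phi> z) \<noteq> snd z"
    then have ne: "\<bar>snd z - val (\<phi> z)\<bar> > 0" by simp
    obtain n where "gm / \<bar>snd z - val (\<phi> z)\<bar> < gm ^ n"
      using real_arch_pow[OF gm_gt_1] by blast
    then show False using bd[of n] ne by (simp add: field_simps)
  qed
qed

lemma creg_\<phi>: "z \<in> UNIV \<times> {0..gm} \<Longrightarrow> creg (\<phi> z) = R_s \<longleftrightarrow> z \<in> UNIV \<times> S"
  unfolding creg_iff by (cases z) (simp add: val_\<phi> S_def)

text \<open>A visit to \<open>S\<close> shifts the first component once and no other step changes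
  it.\<close>

lemma fst_K_funpow:
  assumes z: "z \<in> UNIV \<times> {0..gm}"
  shows "fst ((K ^^ n) z) = (shift ^^ visits (\<phi> z) n) (fst z)"
proof (induction n)
  case (Suc n)
  have "creg ((shift ^^ n) (\<phi> z)) = R_s \<longleftrightarrow> (K ^^ n) z \<in> UNIV \<times> S"
    using creg_\<phi>[OF K_funpow_in_space[OF z], of n] by (simp add: \<phi>_K_funpow)
  moreover obtain \<omega> x where "(K ^^ n) z = (\<omega>, x)" by fastforce
  ultimately show ?case using Suc by (auto simp: visits_Suc K_def E0_def S_def)
qed simp

text \<open>The counter is unbounded and grows by at most one per step, so it passes from
  \<open>j\<close> to \<open>Suc j\<close> at some time, and that time is a visit.\<close>

lemma visits_surj:
  assumes "infinite {n. creg ((shift ^^ n) b) = R_s}"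
  shows "\<exists>n. creg ((shift ^^ n) b) = R_s \<and> visits b n = j"
proof -
  have unb: "\<exists>n. visits b n \<ge> k" for k
  proof (induction k)
    case (Suc k)
    then obtain n where n: "k \<le> visits b n" by blast
    obtain n' where n': "n' \<ge> n" "creg ((shift ^^ n') b) = R_s"
      using assms by (metis (mono_tags, lifting) infinite_nat_iff_unbounded_le mem_Collect_eq)
    have "mono (visits b)" by (rule mono_iff_le_Suc[THEN iffD2]) (simp add: visits_Suc)
    then have "visits b n \<le> visits b n'" using n'(1) by (rule monoD)
    then have "visits b (Suc n') \<ge> Suc k" using n n'(2) by (simp add: visits_Suc)
    then show ?case by blast
  qed simp
  define n where "n = (LEAST n. visits b n \<ge> Suc j)"
  have n: "visits b n \<ge> Suc j" unfolding n_def by (rule LeastI_ex[OF unb])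
  then obtain n' where n': "n = Suc n'" by (cases n) auto
  have "\<not> visits b n' \<ge> Suc j" using n' not_less_Least[of n' "\<lambda>n. visits b n \<ge> Suc j"] by (simp add: n_def)
  then show ?thesis using n n'
    by (intro exI[of _ n']) (cases "creg ((shift ^^ n') b) = R_s"; simp add: visits_Suc)
qed

text \<open>On \<open>Z\<close> every bit of the first component is eventually consumed by a visit
  to \<open>S\<close> and appears there as a digit, so the digits remember all of it.\<close>

lemma \<psi>_\<phi>:
  assumes "z \<in> Z"
  shows "\<psi> (\<phi> z) = z"
proof -
  have z: "z \<in> UNIV \<times> {0..gm}" and inf: "infinite {n. (K ^^ n) z \<in> UNIV \<times> S}"
    using assms by (auto simp: Z_def)
  have reg: "creg ((shift ^^ n) (\<phi> z)) = R_s \<longleftrightarrow> (K ^^ n) z \<in> UNIV \<times> S" for n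
    using creg_\<phi>[OF K_funpow_in_space[OF z], of n] by (simp add: \<phi>_K_funpow)
  have digit: "\<phi> z n = fst z (visits (\<phi> z) n)" if "creg ((shift ^^ n) (\<phi> z)) = R_s" for n
  proof -
    obtain \<omega> x where *: "(K ^^ n) z = (\<omega>, x)" by fastforce
    then have "\<phi> z n = \<omega> 0" using that unfolding reg by (auto simp: \<phi>_def digit1_def E1_def S_def)
    then show ?thesis using fst_K_funpow[OF z, of n] * by (simp add: shift_funpow)
  qed
  have "choices (\<phi> z) j = fst z j" for j
  proof -
    obtain n where "creg ((shift ^^ n) (\<phi> z)) = R_s" "visits (\<phi> z) n = j"
      using visits_surj[of "\<phi> z" j] inf unfolding reg[symmetric] by auto
    then show ?thesis unfolding choices_def using digit by blast
  qed
  then show ?thesis using val_\<phi>[OF z] by (auto simp: \<psi>_def prod_eq_iff)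
qed

text \<open>Turns the image in the definition of \<nu> into a preimage under \<psi>, for which
  measurability is immediate.\<close>

lemma \<phi>_image: "\<phi> ` (A \<inter> Z) = {b. \<psi> b \<in> A \<and> \<psi> b \<in> Z}"
proof (intro subset_antisym subsetI)
  fix b assume "b \<in> {b. \<psi> b \<in> A \<and> \<psi> b \<in> Z}"
  then show "b \<in> \<phi> ` (A \<inter> Z)" by (intro image_eqI[of _ _ "\<psi> b"]) (simp_all add: \<phi>_\<psi>)
qed (auto simp: \<psi>_\<phi>)

section \<open>Measurability of the maps\<close>

lemma measurable_shift [measurable]: "shift \<in> measurable bitseq_space bitseq_space"
  unfolding shift_def by (intro measurable_abs_UNIV measurable_component_singleton) simp

lemma measurable_funpow_shift [measurable]: "shift ^^ n \<in> measurable bitseq_space bitseq_space"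
  by (induction n) (auto intro: measurable_comp)

lemma measurable_bit [measurable (raw)]:
  "f \<in> measurable M bitseq_space \<Longrightarrow> Measurable.pred M (\<lambda>x. f x n)"
  by (rule measurable_compose[OF _ measurable_component_singleton]) auto

lemma measurable_val [measurable]: "val \<in> borel_measurable bitseq_space"
  unfolding val_def by measurable

lemma measurable_creg [measurable]: "creg \<in> measurable bitseq_space (count_space UNIV)"
  unfolding creg_def region_of_def E0_def S_def by simp measurable

lemma measurable_visits [measurable]:
  "(\<lambda>b. visits b n) \<in> measurable bitseq_space (count_space UNIV)"
proof (induction n)
  case (Suc n)
  note Suc[measurable]
  show ?case unfolding visits_Suc by measurable
qed (simp add: visits_def)

lemma measurable_choices [measurable]: "choices \<in> measurable bitseq_space bitseq_space"
  unfolding choices_def by (intro measurable_abs_UNIV) measurable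

lemma measurable_\<psi> [measurable]: "\<psi> \<in> measurable bitseq_space phase_space"
  unfolding phase_space_def \<psi>_def
  by (intro measurable_Pair measurable_restrict_space2) (auto simp: val_nonneg val_le)

lemma measurable_fst_phase_space [measurable]: "fst \<in> measurable phase_space bitseq_space"
  unfolding phase_space_def by measurable

lemma measurable_snd_phase_space [measurable]: "snd \<in> borel_measurable phase_space"
  unfolding phase_space_def
  by (rule measurable_compose[OF measurable_snd]) (rule measurable_restrict_space1, simp)

lemma K_measurable [measurable]: "K \<in> measurable phase_space phase_space"
proof -
  have 1: "(\<lambda>z. fst (K z)) = (\<lambda>z. if snd z \<in> S then shift (fst z) else fst z)"
    and 2: "(\<lambda>z. snd (K z)) = (\<lambda>z. gm * snd z - (if snd z \<in> E0 \<or> snd z \<in> S \<and> \<not> fst z 0 then 0 else 1))"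
    by (auto simp: K_def T_def E0_def S_def fun_eq_iff)
  have "(\<lambda>z. fst (K z)) \<in> measurable phase_space bitseq_space"
    unfolding 1 S_def by measurable
  moreover have "(\<lambda>z. snd (K z)) \<in> borel_measurable phase_space"
    unfolding 2 S_def E0_def by measurable
  moreover have "snd (K z) \<in> {0..gm}" if "z \<in> space phase_space" for z
    using K_in_space[of z] that by (auto simp: space_phase_space)
  ultimately have "(\<lambda>z. (fst (K z), snd (K z))) \<in> measurable phase_space phase_space"
    by (subst (2) phase_space_def) (intro measurable_Pair measurable_restrict_space2, auto)
  then show ?thesis by simp
qed

lemma K_funpow_measurable [measurable]: "K ^^ n \<in> measurable phase_space phase_space"
  by (induction n) (auto intro: measurable_comp)

lemma region_of_measurable [measurable]: "region_of \<in> measurable phase_space (count_space UNIV)"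
  unfolding region_of_def E0_def S_def case_prod_beta by simp measurable

lemma digit1_measurable [measurable]: "Measurable.pred phase_space digit1"
  unfolding digit1_def E1_def S_def case_prod_beta by measurable

lemma \<phi>_measurable [measurable]: "\<phi> \<in> measurable phase_space bitseq_space"
  unfolding \<phi>_def by (intro measurable_abs_UNIV) measurable

lemma \<alpha>_measurable [measurable]: "(\<lambda>z. \<alpha> z n) \<in> measurable phase_space (count_space UNIV)"
  unfolding \<alpha>_def by measurable

lemma Z_sets [measurable]: "Z \<in> sets phase_space"
proof -
  have "Z = {z \<in> space phase_space. \<forall>k. \<exists>n>k. snd ((K ^^ n) z) \<in> S}"
    by (auto simp: Z_def space_phase_space infinite_nat_iff_unbounded mem_Times_iff)
  also have "\<dots> \<in> sets phase_space" unfolding S_def by measurable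
  finally show ?thesis .
qed

section \<open>The Bernoulli measure\<close>

text \<open>Transition of regions under the inverse branches \<open>x / gm\<close> and
  \<open>(x + 1) / gm\<close>. These send the ends of the regions to ends of regions, so away from
  the ends the region of the image depends only on the region of \<open>x\<close>.\<close>

fun pull :: "bool \<Rightarrow> region \<Rightarrow> region" where
  "pull False r = (if r = R_e1 then R_s else R_e0)"
| "pull True r = (if r = R_e0 then R_s else R_e1)"

text \<open>Consequently the regions of a sequence and of its shift together determine the first
  digit.\<close>

lemma pull_inj: "pull d r = pull d' r \<Longrightarrow> d = d'"
  by (cases d; cases d') (auto split: if_splits)

text \<open>The two values at which \<open>pull\<close> gives the wrong region: prepending 0 to the
  value 1 gives \<open>1 / gm\<close>, prepending 1 to the value \<open>1 / gm\<close> gives 1, and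
  both lie in the closed interval \<open>S\<close>.\<close>

definition endpoint :: "binseq \<Rightarrow> bool" where
  "endpoint b \<longleftrightarrow> val b = 1 \<or> val b = 1 / gm"

lemma creg_case_nat:
  assumes "\<not> endpoint b"
  shows "creg (case_nat d b) = pull d (creg b)"
proof -
  have "1 / gm < 1" using gm_gt_1 by simp
  have 0: "val (case_nat False b) < 1 / gm \<longleftrightarrow> val b < 1" "val (case_nat False b) \<le> 1"
    using gm_gt_1 val_le[of b] by (auto simp: val_case_nat field_simps)
  have 1: "1 < val (case_nat True b) \<longleftrightarrow> 1 / gm < val b" "1 / gm \<le> val (case_nat True b)"
    using gm_gt_1 val_nonneg[of b] gm_square unfolding val_case_nat inverse_gm
    by (auto simp: field_simps)
  show ?thesis
    using assms 0 1 \<open>1 / gm < 1\<close>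
    by (cases d; cases "creg b") (auto simp: creg_iff endpoint_def simp del: less_divide_eq_1 divide_less_eq_1)
qed

lemma creg_pull: "\<not> endpoint (shift b) \<Longrightarrow> creg b = pull (b 0) (creg (shift b))"
  using creg_case_nat[of "shift b" "b 0"] by (simp add: case_nat_shift)

lemma measurable_endpoint [measurable]: "Measurable.pred bitseq_space endpoint"
  unfolding endpoint_def by measurable

lemma pred_sets_bitseq: "Measurable.pred bitseq_space P \<Longrightarrow> {b. P b} \<in> sets bitseq_space"
  by (simp add: pred_def space_PiM)

section \<open>Test functions for the Bernoulli measure\<close>

lemma sets_m [simp, measurable_cong]: "sets (m p) = sets bitseq_space"
  unfolding m_def by (intro sets_PiM_cong) auto

lemma space_m [simp]: "space (m p) = UNIV"
  by (simp add: m_def space_PiM)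

lemma prob_space_m: "prob_space (m p)"
  unfolding m_def by (intro prob_space_PiM prob_space_measure_pmf)

text \<open>A class of test functions closed under products and measurable substitutions, on which
  integrability is automatic.\<close>

definition bounded_measurable :: "(binseq \<Rightarrow> real) \<Rightarrow> bool" where
  "bounded_measurable f \<longleftrightarrow> f \<in> borel_measurable bitseq_space \<and> (\<exists>C. \<forall>b. \<bar>f b\<bar> \<le> C)"

lemma bounded_measurableD [measurable_dest]:
  "bounded_measurable f \<Longrightarrow> f \<in> borel_measurable bitseq_space"
  by (simp add: bounded_measurable_def)

lemma bounded_measurableI:
  "f \<in> borel_measurable bitseq_space \<Longrightarrow> (\<And>b. \<bar>f b\<bar> \<le> C) \<Longrightarrow> bounded_measurable f"
  by (auto simp: bounded_measurable_def)

lemma bounded_measurable_const [simp, intro]: "bounded_measurable (\<lambda>_. c)"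
  by (intro bounded_measurableI) auto

lemma bounded_measurable_mult [intro]:
  assumes "bounded_measurable f" "bounded_measurable g"
  shows "bounded_measurable (\<lambda>b. f b * g b)"
proof -
  obtain B C where "\<And>b. \<bar>f b\<bar> \<le> B" "\<And>b. \<bar>g b\<bar> \<le> C"
    using assms unfolding bounded_measurable_def by blast
  then have "\<bar>f b * g b\<bar> \<le> B * C" for b
    by (simp add: abs_mult) (meson abs_ge_zero mult_mono order_trans)
  with assms show ?thesis by (intro bounded_measurableI) auto
qed

lemma bounded_measurable_compose:
  assumes "bounded_measurable f" "g \<in> measurable bitseq_space bitseq_space"
  shows "bounded_measurable (\<lambda>b. f (g b))"
proof -
  note assms(2)[measurable]
  show ?thesis
  using assms(1) by (auto simp: bounded_measurable_def)
qed

lemma bounded_measurable_of_bool [intro]: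
  "Measurable.pred bitseq_space P \<Longrightarrow> bounded_measurable (\<lambda>b. of_bool (P b))"
  by (intro bounded_measurableI[of _ 1]) auto

lemma measurable_case_nat_const [measurable]: "case_nat d \<in> measurable bitseq_space bitseq_space"
  by measurable

lemma bounded_measurable_case_nat:
  "bounded_measurable f \<Longrightarrow> bounded_measurable (\<lambda>b. f (case_nat d b))"
  by (erule bounded_measurable_compose) measurable

section \<open>Prepending a random digit\<close>

locale golden_mean_measure =
  fixes p :: real
  assumes p_pos: "0 < p" and p_less_1: "p < 1"
begin

sublocale prob_space "m p"
  by (rule prob_space_m)

text \<open>Normalising constant of \<open>q\<close>, equal to
  \<open>p^2 + p * (1 - p) + (1 - p)^2\<close>.\<close>

definition c :: real where "c = p\<^sup>2 - p + 1"

lemma c_pos: "c > 0"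
proof -
  have "c = (p - 1/2)\<^sup>2 + 3/4" by (simp add: c_def power2_eq_square field_simps)
  then show ?thesis using zero_le_power2[of "p - 1/2"] by linarith
qed

lemma integrable_bounded [simp]: "bounded_measurable f \<Longrightarrow> integrable (m p) f"
  unfolding bounded_measurable_def
  by (elim conjE exE, rule integrable_const_bound) auto

text \<open>Prepending an independent digit preserves the product measure; Fubini then separates the
  two values of that digit. Every later computation of a law goes through this recursion.\<close>

lemma integral_step:
  assumes f: "bounded_measurable f"
  shows "expectation f = p * expectation (\<lambda>b. f (case_nat False b)) + (1 - p) * expectation (\<lambda>b. f (case_nat True b))"
proof -
  let ?B = "measure_pmf (bernoulli_pmf (1 - p))"
  interpret B: sequence_space ?B by unfold_locales
  interpret P: pair_prob_space ?B "m p" by unfold_locales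
  note f[measurable]
  obtain C where C: "\<And>b. \<bar>f b\<bar> \<le> C" using f by (auto simp: bounded_measurable_def)
  have eq: "distr (?B \<Otimes>\<^sub>M m p) (m p) (\<lambda>(d, b). case_nat d b) = m p"
    unfolding m_def by (rule B.PiM_iter)
  have [measurable]: "(\<lambda>(d, b). case_nat d b) \<in> measurable (?B \<Otimes>\<^sub>M m p) (m p)"
    by measurable
  have [measurable]: "(\<lambda>(d, b). f (case_nat d b)) \<in> borel_measurable (?B \<Otimes>\<^sub>M m p)"
    unfolding case_prod_beta' by (rule measurable_compose[OF _ bounded_measurableD[OF f]]) simp
  have int: "integrable (?B \<Otimes>\<^sub>M m p) (\<lambda>(d, b). f (case_nat d b))"
    by (rule P.P.integrable_const_bound[of _ C]) (use C in auto)
  have "expectation f = (\<integral>x. f x \<partial>distr (?B \<Otimes>\<^sub>M m p) (m p) (\<lambda>(d, b). case_nat d b))"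
    unfolding eq ..
  also have "\<dots> = (\<integral>x. (case x of (d, b) \<Rightarrow> f (case_nat d b)) \<partial>(?B \<Otimes>\<^sub>M m p))"
    by (subst integral_distr) (auto simp: case_prod_beta')
  also have "\<dots> = (\<integral>d. \<integral>b. f (case_nat d b) \<partial>m p \<partial>?B)"
    using P.integral_fst'[OF int] by simp
  also have "\<dots> = p * expectation (\<lambda>b. f (case_nat False b)) + (1 - p) * expectation (\<lambda>b. f (case_nat True b))"
    using p_pos p_less_1 by simp
  finally show ?thesis .
qed

lemma expectation_of_bool: "Measurable.pred bitseq_space P \<Longrightarrow> expectation (\<lambda>b. of_bool (P b)) = prob {b. P b}"
proof -
  have eq: "(\<lambda>b. of_bool (P b)) = indicat_real {b. P b}"
    by (auto simp: indicator_def fun_eq_iff)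
  show ?thesis unfolding eq by (subst Bochner_Integration.integral_indicator) simp
qed

lemma prob_step:
  assumes [measurable]: "Measurable.pred bitseq_space P"
  shows "prob {b. P b} = p * prob {b. P (case_nat False b)} + (1 - p) * prob {b. P (case_nat True b)}"
proof -
  have "Measurable.pred bitseq_space (\<lambda>b. P (case_nat d b))" for d by measurable
  then show ?thesis
    using integral_step[of "\<lambda>b. of_bool (P b)"] by (simp add: expectation_of_bool bounded_measurable_of_bool)
qed

lemma AE_iff_prob_0:
  assumes [measurable]: "Measurable.pred bitseq_space P"
  shows "(AE b in m p. \<not> P b) \<longleftrightarrow> prob {b. P b} = 0"
proof -
  have "{b. P b} \<in> events" using assms by (simp add: pred_sets_bitseq)
  then show ?thesis by (subst AE_iff_measurable[of "{b. P b}"]) (auto simp: emeasure_eq_measure)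
qed

text \<open>Since \<open>shift\<close> undoes either \<open>case_nat\<close>, the recursion
  \<open>prob_step\<close> gives the preimage of a null set probability 0.\<close>

lemma AE_shift:
  assumes "AE b in m p. Q b"
  shows "AE b in m p. Q (shift b)"
proof -
  from assms obtain N where N: "{b. \<not> Q b} \<subseteq> N" "emeasure (m p) N = 0" "N \<in> sets bitseq_space"
    by (auto elim!: AE_E)
  have [measurable]: "Measurable.pred bitseq_space (\<lambda>b. b \<in> N)" using N(3) by simp
  have "prob {b. b \<in> N} = 0" using N(2) by (simp add: measure_def)
  then have "prob {b. shift b \<in> N} = 0"
    by (subst prob_step) simp_all
  then have "AE b in m p. \<not> shift b \<in> N" by (subst AE_iff_prob_0) auto
  then show ?thesis by eventually_elim (use N(1) in auto)
qed

text \<open>The point masses of \<open>val\<close> satisfy a two-term recursion along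
  \<open>gm * x\<close> and \<open>gm * x - 1\<close>. It kills the masses at the fixed points 0 and
  \<open>gm\<close>, and then makes the masses at 1 and \<open>1 / gm\<close> feed only on each
  other with total factor \<open>p * (1 - p) < 1\<close>.\<close>

lemma AE_not_endpoint: "AE b in m p. \<not> endpoint b"
proof -
  let ?P = "\<lambda>x. prob {b. val b = x}"
  have step: "?P x = p * ?P (gm * x) + (1 - p) * ?P (gm * x - 1)" for x
    by (subst prob_step) (auto simp: val_case_nat field_simps intro!: arg_cong2[where f="\<lambda>x y. p * x + y - p * y"] arg_cong[where f=prob])
  have out: "?P x = 0" if "x < 0 \<or> x > gm" for x
  proof -
    have "{b. val b = x} = {}" using that val_nonneg val_le by (auto simp: not_le[symmetric])
    then show ?thesis by simp
  qed
  have "?P 0 = 0" using step[of 0] out[of "-1"] p_less_1 by simp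
  have "gm * gm > gm" "gm * gm - 1 = gm" using gm_gt_1 gm_square by simp_all
  then have "?P gm = 0" using step[of gm] out[of "gm * gm"] p_pos by simp
  have "?P 1 = (1 - p) * ?P (1 / gm)" using step[of 1] \<open>?P gm = 0\<close> inverse_gm by simp
  moreover have "?P (1 / gm) = p * ?P 1" using step[of "1 / gm"] \<open>?P 0 = 0\<close> by simp
  ultimately have "?P 1 = (1 - p) * p * ?P 1" by simp
  moreover have "(1 - p) * p < 1" using c_pos by (simp add: c_def power2_eq_square algebra_simps)
  ultimately have "?P 1 = 0" by (smt (verit) mult_cancel_right1)
  with \<open>?P (1 / gm) = p * ?P 1\<close> have "?P (1 / gm) = 0" by simp
  with \<open>?P 1 = 0\<close> have "AE b in m p. \<not> val b = 1" "AE b in m p. \<not> val b = 1 / gm"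
    by (simp_all add: AE_iff_prob_0 del: divide_eq_eq eq_divide_eq)
  then show ?thesis by eventually_elim (simp add: endpoint_def)
qed

lemma measurable_pull_creg [measurable]:
  "(\<lambda>b. pull d (creg b)) \<in> measurable bitseq_space (count_space UNIV)"
  by (rule measurable_compose[OF measurable_creg]) simp

lemma AE_orbit_not_endpoint: "AE b in m p. \<forall>n. \<not> endpoint ((shift ^^ n) b)"
proof -
  have "AE b in m p. \<not> endpoint ((shift ^^ n) b)" for n
  proof (induction n)
    case (Suc n)
    from AE_shift[OF this] show ?case by (simp add: funpow_Suc_right del: funpow.simps)
  qed (use AE_not_endpoint in simp)
  then show ?thesis by (simp add: AE_all_countable)
qed

text \<open>The sequence \<open>D \<circ> shift ^^ n\<close> is a reversed martingale difference.\<close>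
lemma fair_strong_law:
  assumes D: "bounded_measurable D"
    and fair: "\<And>b. p * D (case_nat False b) + (1 - p) * D (case_nat True b) = 0"
  shows "AE b in m p. (\<lambda>n. (\<Sum>i<n. D ((shift ^^ i) b)) / real n) \<longlonglongrightarrow> 0"
proof -
  note D[measurable]
  obtain C where C: "\<And>b. \<bar>D b\<bar> \<le> C" using D by (auto simp: bounded_measurable_def)
  have bm: "bounded_measurable (\<lambda>b. D ((shift ^^ i) b))" for i
    by (rule bounded_measurable_compose[OF D]) measurable
  \<comment> \<open>Induction on \<open>i\<close> removes the common shifts. For
    \<open>i = 0\<close> the later factor does not involve the first digit, so averaging over that
    digit makes the product vanish by \<open>fair\<close>.\<close>
  have orth: "expectation (\<lambda>b. D ((shift ^^ i) b) * D ((shift ^^ (i + Suc k)) b)) = 0" for i k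
  proof (induction i)
    case 0
    have "expectation (\<lambda>b. D b * D ((shift ^^ Suc k) b)) =
      p * expectation (\<lambda>b. D (case_nat False b) * D ((shift ^^ k) b)) +
      (1 - p) * expectation (\<lambda>b. D (case_nat True b) * D ((shift ^^ k) b))"
      using integral_step[OF bounded_measurable_mult[OF D bm[of "Suc k"]]]
      by (simp add: funpow_Suc_right del: funpow.simps)
    also have "\<dots> = expectation (\<lambda>b. p * (D (case_nat False b) * D ((shift ^^ k) b)) +
      (1 - p) * (D (case_nat True b) * D ((shift ^^ k) b)))"
      using integrable_bounded[OF bounded_measurable_mult[OF bounded_measurable_case_nat[OF D] bm[of k]]]
      by simp
    also have "\<dots> = expectation (\<lambda>b. (p * D (case_nat False b) + (1 - p) * D (case_nat True b)) * D ((shift ^^ k) b))"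
      by (simp add: algebra_simps)
    finally show ?case by (simp add: fair)
  next
    case (Suc i)
    then show ?case
      using integral_step[OF bounded_measurable_mult[OF bm[of "Suc i"] bm[of "Suc i + Suc k"]]]
      by (simp add: funpow_Suc_right del: funpow.simps)
  qed
  show ?thesis
  proof (rule orthogonal_strong_law[of _ C])
    show "expectation (\<lambda>b. D ((shift ^^ i) b) * D ((shift ^^ j) b)) = 0" if "i < j" for i j
      using orth[of i "j - Suc i"] that by simp
    show "(\<lambda>b. D ((shift ^^ i) b)) \<in> borel_measurable (m p)" for i
      using bounded_measurableD[OF bm] by simp
  qed (rule C)
qed

section \<open>Joint law of the first region and the choices\<close>

fun q :: "region \<Rightarrow> real" where
  "q R_e0 = p\<^sup>2 / c"
| "q R_s = p * (1 - p) / c"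
| "q R_e1 = (1 - p)\<^sup>2 / c"

lemma q_pos: "q r > 0"
  using p_pos p_less_1 c_pos by (cases r) auto

lemma q_sum: "q R_e0 + q R_s + q R_e1 = 1"
  using c_pos by (simp add: add_divide_distrib[symmetric]) (simp add: c_def power2_eq_square algebra_simps)

text \<open>These are the stationarity equations \<open>q R_e0 = p * (q R_e0 + q R_s)\<close> and
  \<open>q R_e1 = (1 - p) * (q R_s + q R_e1)\<close> rearranged: \<open>q\<close> is the stationary
  law of the chain of regions obtained by prepending random digits.\<close>

lemma q_balance: "(1 - p) * q R_e0 = p * q R_s" "p * q R_e1 = (1 - p) * q R_s"
  by (simp_all add: power2_eq_square)

text \<open>Being in \<open>S\<close> reverses the weights: a digit 0 there must precede
  \<open>R_e1\<close>, with weight \<open>p * (1 - p)^2\<close>, and a digit 1 must precede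
  \<open>R_e0\<close>, with weight \<open>(1 - p) * p^2\<close>. The ratio is \<open>1 - p\<close>
  to \<open>p\<close>.\<close>

definition choice_weight :: "bool \<Rightarrow> real" where
  "choice_weight d = (if d then p else 1 - p)"

definition digit_weight :: "bool \<Rightarrow> real" where
  "digit_weight d = (if d then 1 - p else p)"

text \<open>A conditional expectation before division by the probability of the region, which keeps
  the recursions linear.\<close>

definition cond :: "region \<Rightarrow> (binseq \<Rightarrow> real) \<Rightarrow> real" where
  "cond r f = expectation (\<lambda>b. of_bool (creg b = r) * f (choices b))"

lemma bounded_measurable_cond:
  assumes "bounded_measurable f"
  shows "bounded_measurable (\<lambda>b. of_bool (P (creg b)) * f (choices b))"
  by (intro bounded_measurable_mult bounded_measurable_compose[OF assms] bounded_measurable_of_bool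
      measurable_compose[OF measurable_creg, where g=P]) auto

lemma cond_split:
  assumes f: "bounded_measurable f"
  shows "expectation (\<lambda>b. of_bool (creg b \<in> R) * f (choices b)) = (\<Sum>r\<in>R. cond r f)"
proof -
  have fin: "finite (UNIV :: region set)"
  proof -
    have "(UNIV :: region set) = {R_e0, R_s, R_e1}" using region.exhaust by auto
    then show ?thesis by (metis finite.emptyI finite_insert)
  qed
  have "of_bool (creg b \<in> R) * f (choices b) = (\<Sum>r\<in>R. of_bool (creg b = r) * f (choices b))" for b
    unfolding sum_distrib_right[symmetric] using finite_subset[OF subset_UNIV fin, of R]
    by (simp add: of_bool_def)
  moreover have "expectation (\<lambda>b. \<Sum>r\<in>R. of_bool (creg b = r) * f (choices b)) = (\<Sum>r\<in>R. cond r f)"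
    unfolding cond_def
    by (intro Bochner_Integration.integral_sum integrable_bounded bounded_measurable_cond[OF f])
  ultimately show ?thesis by simp
qed

text \<open>Condition on the first digit and read the new region off \<open>pull\<close>. Only a
  start in \<open>S\<close> adds a choice, so the first two equations involve the same
  \<open>f\<close> on both sides.\<close>

lemma cond_rec:
  assumes f: "bounded_measurable f"
  shows "cond R_e0 f = p * (cond R_e0 f + cond R_s f)"
    and "cond R_e1 f = (1 - p) * (cond R_s f + cond R_e1 f)"
    and "cond R_s f = p * cond R_e1 (\<lambda>v. f (case_nat False v)) + (1 - p) * cond R_e0 (\<lambda>v. f (case_nat True v))"
proof -
  have step: "cond r f = p * expectation (\<lambda>b. of_bool (pull False (creg b) = r) * f (if r = R_s then case_nat False (choices b) else choices b))
      + (1 - p) * expectation (\<lambda>b. of_bool (pull True (creg b) = r) * f (if r = R_s then case_nat True (choices b) else choices b))" for r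
  proof -
    have [measurable]: "f \<in> borel_measurable bitseq_space" using f by measurable
    have [measurable]: "(\<lambda>b. if r = R_s then case_nat d (choices b) else choices b) \<in> measurable bitseq_space bitseq_space" for d
      by (cases "r = R_s") simp_all
    have "expectation (\<lambda>b. of_bool (creg (case_nat d b) = r) * f (choices (case_nat d b))) =
      expectation (\<lambda>b. of_bool (pull d (creg b) = r) * f (if r = R_s then case_nat d (choices b) else choices b))" for d
    proof (rule integral_cong_AE)
      show "AE b in m p. of_bool (creg (case_nat d b) = r) * f (choices (case_nat d b)) =
        of_bool (pull d (creg b) = r) * f (if r = R_s then case_nat d (choices b) else choices b)"
        using AE_not_endpoint
        by eventually_elim (auto simp: creg_case_nat choices_rec[of "case_nat d _"])
    qed measurable
    moreover have "bounded_measurable (\<lambda>b. of_bool (creg b = r) * f (choices b))"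
      by (rule bounded_measurable_cond[OF f])
    ultimately show ?thesis unfolding cond_def by (subst integral_step) auto
  qed
  have *: "pull False r = R_e0 \<longleftrightarrow> r \<in> {R_e0, R_s}" "pull True r = R_e0 \<longleftrightarrow> r \<in> {}"
    "pull False r = R_e1 \<longleftrightarrow> r \<in> {}" "pull True r = R_e1 \<longleftrightarrow> r \<in> {R_s, R_e1}"
    "pull False r = R_s \<longleftrightarrow> r \<in> {R_e1}" "pull True r = R_s \<longleftrightarrow> r \<in> {R_e0}" for r
    by (cases r; simp)+
  have sum_e0: "(\<Sum>r\<in>{R_e0, R_s}. cond r f) = cond R_e0 f + cond R_s f"
    and sum_e1: "(\<Sum>r\<in>{R_s, R_e1}. cond r f) = cond R_s f + cond R_e1 f"
    by simp_all
  show "cond R_e0 f = p * (cond R_e0 f + cond R_s f)"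
    using step[of R_e0] cond_split[OF f, of "{R_e0, R_s}"] unfolding * by (simp del: insert_iff add: sum_e0)
  show "cond R_e1 f = (1 - p) * (cond R_s f + cond R_e1 f)"
    using step[of R_e1] cond_split[OF f, of "{R_s, R_e1}"] unfolding * by (simp del: insert_iff add: sum_e1)
  show "cond R_s f = p * cond R_e1 (\<lambda>v. f (case_nat False v)) + (1 - p) * cond R_e0 (\<lambda>v. f (case_nat True v))"
    using step[of R_s] unfolding * by (simp add: cond_def)
qed

lemma creg_cases: "creg b = R_e0 \<or> creg b = R_s \<or> creg b = R_e1"
  by (cases "creg b") auto

text \<open>The first two equations of \<open>cond_rec\<close> express the outer regions through
  \<open>R_s\<close>, and total mass 1 then fixes \<open>R_s\<close>.\<close>

lemma cond_const: "cond r (\<lambda>_. a) = a * q r"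
proof -
  let ?x = "\<lambda>r. cond r (\<lambda>_. 1)"
  have e0: "(1 - p) * ?x R_e0 = p * ?x R_s" and e1: "p * ?x R_e1 = (1 - p) * ?x R_s"
    using cond_rec(1,2)[of "\<lambda>_. 1"] by (simp_all add: algebra_simps)
  have "(\<Sum>r\<in>{R_e0, R_s, R_e1}. ?x r) = expectation (\<lambda>b. 1)"
    unfolding cond_split[OF bounded_measurable_const, symmetric]
    by (intro arg_cong[where f=expectation] ext) (simp add: creg_cases)
  then have sum: "?x R_e0 + ?x R_s + ?x R_e1 = 1" using prob_space by simp
  have "p * (1 - p) * (?x R_e0 + ?x R_s + ?x R_e1) = p * ((1 - p) * ?x R_e0) + p * (1 - p) * ?x R_s + (1 - p) * (p * ?x R_e1)"
    by (simp add: algebra_simps)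
  also have "\<dots> = c * ?x R_s" unfolding e0 e1 by (simp add: c_def power2_eq_square algebra_simps)
  finally have s: "?x R_s = q R_s" unfolding sum using c_pos by (simp add: field_simps)
  have "(1 - p) * ?x R_e0 = (1 - p) * q R_e0" "p * ?x R_e1 = p * q R_e1"
    unfolding e0 e1 s q_balance by (rule refl)+
  then have "?x R_e0 = q R_e0" "?x R_e1 = q R_e1"
    using p_pos p_less_1 by (simp_all del: q.simps)
  with s have "?x r = q r" by (cases r) auto
  moreover have "cond r (\<lambda>_. a) = a * ?x r" by (simp add: cond_def mult.commute)
  ultimately show ?thesis by simp
qed

definition choice_mean :: "(binseq \<Rightarrow> real) \<Rightarrow> real" where
  "choice_mean f = expectation (\<lambda>b. f (choices b))"

text \<open>Independence of the first region and the choices. For fixed \<open>f\<close> the first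
  two recursions force the three values \<open>cond r f\<close> to be proportional to
  \<open>q\<close>; summing over the regions identifies the factor \<open>e\<close> as the
  unrestricted mean.\<close>

lemma cond_eq:
  assumes f: "bounded_measurable f"
  shows "cond r f = q r * choice_mean f"
proof -
  have e0: "(1 - p) * cond R_e0 f = p * cond R_s f" and e1: "p * cond R_e1 f = (1 - p) * cond R_s f"
    using cond_rec(1,2)[OF f] by (simp_all add: algebra_simps)
  define e where "e = cond R_s f / q R_s"
  have s: "cond R_s f = q R_s * e" using q_pos[of R_s] by (simp add: e_def del: q.simps)
  have "(1 - p) * cond R_e0 f = (1 - p) * (q R_e0 * e)"
    unfolding e0 s mult.assoc[symmetric] q_balance ..
  moreover have "p * cond R_e1 f = p * (q R_e1 * e)"
    unfolding e1 s mult.assoc[symmetric] q_balance ..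
  ultimately have "cond R_e0 f = q R_e0 * e" "cond R_e1 f = q R_e1 * e"
    using p_pos p_less_1 by (simp_all del: q.simps)
  with s have *: "cond r f = q r * e" for r by (cases r) (auto simp del: q.simps)
  have "choice_mean f = (\<Sum>r\<in>{R_e0, R_s, R_e1}. cond r f)"
    unfolding cond_split[OF f, symmetric] choice_mean_def
    by (intro arg_cong[where f=expectation] ext) (simp add: creg_cases)
  also have "\<dots> = (q R_e0 + q R_s + q R_e1) * e" by (simp add: * algebra_simps del: q.simps)
  finally show ?thesis using * q_sum by simp
qed

text \<open>The third recursion of \<open>cond_rec\<close> after inserting independence and
  cancelling \<open>q R_s\<close>. It has the form of \<open>integral_step\<close> with
  \<open>p\<close> and \<open>1 - p\<close> interchanged, so the choices behave as i.i.d. bits equal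
  to \<open>True\<close> with probability \<open>p\<close>.\<close>

lemma choice_mean_rec:
  assumes f: "bounded_measurable f"
  shows "choice_mean f = (1 - p) * choice_mean (\<lambda>v. f (case_nat False v)) + p * choice_mean (\<lambda>v. f (case_nat True v))"
proof -
  have "q R_s * choice_mean f = p * q R_e1 * choice_mean (\<lambda>v. f (case_nat False v))
    + (1 - p) * q R_e0 * choice_mean (\<lambda>v. f (case_nat True v))"
    using cond_rec(3)[OF f] by (simp add: cond_eq f bounded_measurable_case_nat del: q.simps)
  also have "\<dots> = q R_s * ((1 - p) * choice_mean (\<lambda>v. f (case_nat False v)) + p * choice_mean (\<lambda>v. f (case_nat True v)))"
    unfolding q_balance distrib_left by (simp del: q.simps)
  finally show ?thesis using q_pos[of R_s] by (simp del: q.simps)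
qed

section \<open>Laws of large numbers and cylinders\<close>

lemma choice_mean_const [simp]: "choice_mean (\<lambda>_. a) = a"
  using prob_space by (simp add: choice_mean_def)

lemma bounded_measurable_prefix:
  "bounded_measurable (\<lambda>v. of_bool (\<forall>j<l. v j = w j))"
  by (rule bounded_measurable_of_bool) measurable

lemma choice_mean_prefix:
  "choice_mean (\<lambda>v. of_bool (\<forall>j<l. v j = w j)) = (\<Prod>j<l. choice_weight (w j))"
proof (induction l arbitrary: w)
  case (Suc l)
  have "(\<forall>j<Suc l. case_nat d v j = w j) \<longleftrightarrow> d = w 0 \<and> (\<forall>j<l. v j = w (Suc j))" for d v
    by (auto simp: All_less_Suc2)
  then have "choice_mean (\<lambda>v. of_bool (\<forall>j<Suc l. case_nat d v j = w j)) =
      of_bool (d = w 0) * (\<Prod>j<l. choice_weight (w (Suc j)))" for d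
    using Suc.IH[of "\<lambda>j. w (Suc j)"] by (cases "d = w 0") simp_all
  then show ?case
    unfolding choice_mean_rec[OF bounded_measurable_prefix, of "Suc l"]
    by (simp add: prod.lessThan_Suc_shift choice_weight_def del: prod.lessThan_Suc)
qed simp

lemma bounded_measurable_coordinate: "bounded_measurable (\<lambda>v. g (v j))" for g :: "bool \<Rightarrow> real"
proof (rule bounded_measurableI)
  show "\<bar>g (v j)\<bar> \<le> max \<bar>g True\<bar> \<bar>g False\<bar>" for v :: binseq by (cases "v j") auto
  show "(\<lambda>v. g (v j)) \<in> borel_measurable bitseq_space"
    by (rule measurable_compose[OF measurable_component_singleton]) auto
qed

lemma choice_mean_mult: "choice_mean (\<lambda>v. a * f v) = a * choice_mean f"
  by (simp add: choice_mean_def)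

text \<open>\<open>choice_mean_rec\<close> peels off leading bits one by one, which shows that the
  bits centred at \<open>p\<close> have mean 0 and are pairwise orthogonal.\<close>

lemma choices_strong_law:
  "AE b in m p. (\<lambda>n. (\<Sum>j<n. of_bool (choices b j) - p) / real n) \<longlonglongrightarrow> 0"
proof (rule orthogonal_strong_law[of _ 1])
  define Y where "Y d = of_bool d - p" for d
  have bm: "bounded_measurable (\<lambda>v. Y (v j))" for j by (rule bounded_measurable_coordinate)
  have mean: "choice_mean (\<lambda>v. Y (v j)) = 0" for j
    by (induction j) (subst choice_mean_rec[OF bm]; simp add: Y_def algebra_simps)+
  have orth: "choice_mean (\<lambda>v. Y (v i) * Y (v (i + Suc k))) = 0" for i k
    by (induction i)
       (subst choice_mean_rec[OF bounded_measurable_mult[OF bm bm]]; simp add: choice_mean_mult mean)+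
  show "expectation (\<lambda>b. (of_bool (choices b i) - p) * (of_bool (choices b j) - p)) = 0" if "i < j" for i j
    using orth[of i "j - Suc i"] that by (simp add: choice_mean_def Y_def)
  show "\<bar>of_bool (choices b i) - p\<bar> \<le> 1" for i b
    using p_pos p_less_1 by auto
qed measurable

lemma digits_strong_law:
  "AE b in m p. (\<lambda>n. (\<Sum>i<n. of_bool (b i) - (1 - p)) / real n) \<longlonglongrightarrow> 0"
proof -
  have "AE b in m p. (\<lambda>n. (\<Sum>i<n. of_bool (((shift ^^ i) b) 0) - (1 - p)) / real n) \<longlonglongrightarrow> 0"
    using bounded_measurable_coordinate[of "\<lambda>d. of_bool d - (1 - p)" 0]
    by (rule fair_strong_law) (simp add: algebra_simps)
  then show ?thesis by (simp add: shift_funpow)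
qed

text \<open>\<open>G\<close> solves the Poisson equation of the backward chain, \<open>G r - Q r = of_bool (r = R_s) - q R_s\<close>,
  normalised by \<open>G R_s = 0\<close>.\<close>
lemma visits_strong_law:
  "AE b in m p. (\<lambda>n. real (visits b n) / real n) \<longlonglongrightarrow> q R_s"
proof -
  define G where "G r = (case r of R_e0 \<Rightarrow> - p / c | R_s \<Rightarrow> 0 | R_e1 \<Rightarrow> - (1 - p) / c)" for r
  define Q where "Q r = p * G (pull False r) + (1 - p) * G (pull True r)" for r
  \<comment> \<open>The \<open>pull\<close> term replaces \<open>creg b\<close>, to which it is
    equal unless \<open>shift b\<close> is an endpoint; in this form the fairness condition holds
    for every \<open>b\<close>.\<close>
  define D where "D b = G (pull (b 0) (creg (shift b))) - Q (creg (shift b))" for b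
  have G: "\<bar>G r\<bar> \<le> 1 / c" for r
    using p_pos p_less_1 c_pos by (cases r) (auto simp: G_def divide_right_mono)
  have Q: "\<bar>Q r\<bar> \<le> 1 / c" for r
  proof -
    have "\<bar>Q r\<bar> \<le> p * \<bar>G (pull False r)\<bar> + (1 - p) * \<bar>G (pull True r)\<bar>"
      unfolding Q_def using p_pos p_less_1 by (simp add: abs_mult order_trans[OF abs_triangle_ineq])
    also have "\<dots> \<le> p * (1 / c) + (1 - p) * (1 / c)"
      using G p_pos p_less_1 by (intro add_mono mult_left_mono) auto
    also have "\<dots> = 1 / c" by (simp add: add_divide_distrib[symmetric])
    finally show ?thesis .
  qed
  have poisson: "G r - Q r = of_bool (r = R_s) - q R_s" for r
    using c_pos by (cases r) (simp_all add: G_def Q_def field_simps, simp_all add: c_def power2_eq_square algebra_simps)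
  have bm: "bounded_measurable D"
  proof (rule bounded_measurableI)
    show "\<bar>D b\<bar> \<le> 2 / c" for b
      unfolding D_def using G[of "pull (b 0) (creg (shift b))"] Q[of "creg (shift b)"] by (auto simp: abs_le_iff)
    have [measurable]: "g \<in> borel_measurable (count_space UNIV)" for g :: "region \<Rightarrow> real" by simp
    have "D = (\<lambda>b. if b 0 then G (pull True (creg (shift b))) - Q (creg (shift b))
                         else G (pull False (creg (shift b))) - Q (creg (shift b)))"
      by (auto simp: D_def fun_eq_iff)
    also have "\<dots> \<in> borel_measurable bitseq_space" by measurable
    finally show "D \<in> borel_measurable bitseq_space" .
  qed
  have "AE b in m p. (\<lambda>n. (\<Sum>i<n. D ((shift ^^ i) b)) / real n) \<longlonglongrightarrow> 0"
    by (rule fair_strong_law[OF bm]) (simp add: D_def Q_def algebra_simps)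
  then show ?thesis using AE_orbit_not_endpoint
  proof eventually_elim
    case (elim b)
    define r where "r i = creg ((shift ^^ i) b)" for i
    have D: "D ((shift ^^ i) b) = G (r i) - Q (r (Suc i))" for i
      using creg_pull[of "(shift ^^ i) b"] elim(2)[rule_format, of "Suc i"] by (simp add: D_def r_def)
    \<comment> \<open>Adding up the Poisson equation along the orbit telescopes and leaves only a
      bounded boundary term.\<close>
    have "real (visits b n) - real n * q R_s = (\<Sum>i<n. D ((shift ^^ i) b)) + (Q (r n) - Q (r 0))" for n
    proof (induction n)
      case (Suc n)
      then show ?case using poisson[of "r n"] by (simp add: D visits_Suc r_def algebra_simps del: q.simps)
    qed simp
    then have "real (visits b n) = (\<Sum>i<n. D ((shift ^^ i) b)) + (Q (r n) - Q (r 0)) + real n * q R_s" for n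
      by (simp only: diff_eq_eq)
    then have eq: "real (visits b n) / real n =
        (\<Sum>i<n. D ((shift ^^ i) b)) / real n + (Q (r n) - Q (r 0)) / real n + q R_s" if "n > 0" for n
      using that by (simp only: add_divide_distrib nonzero_mult_div_cancel_left of_nat_eq_0_iff neq0_conv not_False_eq_True)
    have "(\<lambda>n. (Q (r n) - Q (r 0)) / real n) \<longlonglongrightarrow> 0"
    proof (rule Lim_null_comparison[OF always_eventually lim_const_over_n])
      show "\<forall>n. norm ((Q (r n) - Q (r 0)) / real n) \<le> (2 / c) / real n"
      proof
        fix n
        have "\<bar>Q (r n) - Q (r 0)\<bar> \<le> 2 / c" using Q[of "r n"] Q[of "r 0"] by (auto simp: abs_le_iff)
        from divide_right_mono[OF this, of "real n"]
        show "norm ((Q (r n) - Q (r 0)) / real n) \<le> (2 / c) / real n" by simp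
      qed
    qed
    then have "(\<lambda>n. (\<Sum>i<n. D ((shift ^^ i) b)) / real n + (Q (r n) - Q (r 0)) / real n + q R_s) \<longlonglongrightarrow> 0 + 0 + q R_s"
      using elim(1) by (intro tendsto_add tendsto_const)
    then have "(\<lambda>n. (\<Sum>i<n. D ((shift ^^ i) b)) / real n + (Q (r n) - Q (r 0)) / real n + q R_s) \<longlonglongrightarrow> q R_s"
      by simp
    then show ?case
      by (rule Lim_transform_eventually) (use eventually_gt_at_top[of 0] in \<open>eventually_elim; simp add: eq del: q.simps\<close>)
  qed
qed

section \<open>Measures of cylinders of regions and choices\<close>

definition cylinder :: "nat \<Rightarrow> nat \<Rightarrow> binseq \<Rightarrow> binseq set" where
  "cylinder n l b = {b'. (\<forall>i\<le>n. creg ((shift ^^ i) b') = creg ((shift ^^ i) b)) \<and> (\<forall>j<l. choices b' j = choices b j)}"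

lemma pred_cylinder:
  "Measurable.pred bitseq_space (\<lambda>b'. b' \<in> cylinder n l b)"
proof -
  have [measurable]: "(\<lambda>b. choices b j) \<in> measurable bitseq_space (count_space UNIV)" for j by measurable
  show ?thesis unfolding cylinder_def by simp measurable
qed

lemma prob_cylinder_0: "prob (cylinder 0 l b) = q (creg b) * (\<Prod>j<l. choice_weight (choices b j))"
proof -
  have "prob (cylinder 0 l b) = expectation (\<lambda>b'. of_bool (b' \<in> cylinder 0 l b))"
    by (simp only: expectation_of_bool[OF pred_cylinder] Collect_mem_eq)
  also have "\<dots> = cond (creg b) (\<lambda>v. of_bool (\<forall>j<l. v j = choices b j))"
    unfolding cond_def cylinder_def by (simp add: of_bool_conj)
  finally show ?thesis by (simp add: cond_eq bounded_measurable_prefix choice_mean_prefix)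
qed

text \<open>Once the tail has the right region, agreement of the first region means agreement of the
  first digit, which contributes its weight. The number of prescribed choices drops only at a visit
  to \<open>S\<close>, hence the separate lengths \<open>n\<close> and \<open>l\<close>.\<close>

lemma prob_cylinder_Suc:
  assumes b: "\<not> endpoint (shift b)" and l: "l \<ge> of_bool (creg b = R_s)"
  shows "prob (cylinder (Suc n) l b) =
    digit_weight (b 0) * prob (cylinder n (l - of_bool (creg b = R_s)) (shift b))"
proof -
  let ?l = "l - of_bool (creg b = R_s)"
  have *: "case_nat d b' \<in> cylinder (Suc n) l b \<longleftrightarrow> d = b 0 \<and> b' \<in> cylinder n ?l (shift b)"
    if b': "\<not> endpoint b'" for d b'
  proof -
    have regs: "(\<forall>i\<le>Suc n. creg ((shift ^^ i) (case_nat d b')) = creg ((shift ^^ i) b)) \<longleftrightarrow>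
       creg (case_nat d b') = creg b \<and> (\<forall>i\<le>n. creg ((shift ^^ i) b') = creg ((shift ^^ i) (shift b)))"
      by (simp add: All_less_Suc2 less_Suc_eq_le[symmetric] funpow_Suc_right del: funpow.simps)
    show ?thesis
    proof (cases "creg b' = creg (shift b)")
      case True
      then have "creg (case_nat d b') = creg b \<longleftrightarrow> d = b 0"
        unfolding creg_case_nat[OF b'] creg_pull[OF b] by (auto dest: pull_inj)
      \<comment> \<open>At a visit the first choice is the first digit, already fixed by the
        regions, so only the other choices constrain the tail.\<close>
      moreover have "(\<forall>j<l. choices (case_nat d b') j = choices b j) \<longleftrightarrow>
        (\<forall>j<?l. choices b' j = choices (shift b) j)" if "creg (case_nat d b') = creg b" "d = b 0"
      proof (cases "creg b = R_s")
        case True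
        then obtain l' where "l = Suc l'" using l by (cases l) auto
        moreover have "choices (case_nat d b') = case_nat d (choices b')" "choices b = case_nat (b 0) (choices (shift b))"
          using True that(1) choices_rec[of b] choices_rec[of "case_nat d b'"] by simp_all
        ultimately show ?thesis using True that(2) by (simp add: All_less_Suc2)
      next
        case False
        then have "choices (case_nat d b') = choices b'" "choices b = choices (shift b)"
          using that(1) choices_rec[of b] choices_rec[of "case_nat d b'"] by simp_all
        then show ?thesis using False by simp
      qed
      ultimately show ?thesis unfolding cylinder_def mem_Collect_eq regs by blast
    next
      case False
      then show ?thesis unfolding cylinder_def mem_Collect_eq regs
        by (auto intro!: exI[of _ 0])
    qed
  qed
  have step: "prob {b'. case_nat d b' \<in> cylinder (Suc n) l b} = of_bool (d = b 0) * prob (cylinder n ?l (shift b))" for d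
  proof -
    have "prob {b'. case_nat d b' \<in> cylinder (Suc n) l b} = prob {b'. d = b 0 \<and> b' \<in> cylinder n ?l (shift b)}"
    \<comment> \<open>The equivalence is available off the endpoints, which have probability
      0.\<close>
    proof (rule measure_eq_AE)
      show "AE b' in m p. b' \<in> {b'. case_nat d b' \<in> cylinder (Suc n) l b} \<longleftrightarrow>
        b' \<in> {b'. d = b 0 \<and> b' \<in> cylinder n ?l (shift b)}"
        using AE_not_endpoint by eventually_elim (simp add: *)
      note pred_cylinder[measurable]
      show "{b'. case_nat d b' \<in> cylinder (Suc n) l b} \<in> events"
        unfolding sets_m by (rule pred_sets_bitseq) measurable
      show "{b'. d = b 0 \<and> b' \<in> cylinder n ?l (shift b)} \<in> events"
        unfolding sets_m by (rule pred_sets_bitseq) measurable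
    qed
    then show ?thesis by simp
  qed
  show ?thesis
    using prob_step[OF pred_cylinder[of "Suc n" l b]] step by (auto simp: digit_weight_def)
qed

lemma prob_cylinder:
  assumes "\<And>i. \<not> endpoint ((shift ^^ i) b)" and "visits b n \<le> l"
  shows "prob (cylinder n l b) = (\<Prod>i<n. digit_weight (b i)) * q (creg ((shift ^^ n) b)) *
    (\<Prod>j\<in>{visits b n..<l}. choice_weight (choices b j))"
  using assms
proof (induction n arbitrary: b l)
  case 0
  then show ?case by (simp add: prob_cylinder_0 lessThan_atLeast0)
next
  case (Suc n)
  let ?l = "l - of_bool (creg b = R_s)"
  have le: "of_bool (creg b = R_s) + visits (shift b) n \<le> l"
    using Suc.prems(2) by (simp add: visits_Suc_shift)
  have ne: "\<not> endpoint ((shift ^^ i) (shift b))" for i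
    using Suc.prems(1)[of "Suc i"] by (simp add: funpow_Suc_right del: funpow.simps)
  have "(\<Prod>j\<in>{visits b (Suc n)..<l}. choice_weight (choices b j)) =
    (\<Prod>j\<in>{visits (shift b) n..<?l}. choice_weight (choices (shift b) j))"
  proof (cases "creg b = R_s")
    case True
    then obtain l' where "l = Suc l'" using le by (cases l) auto
    with True show ?thesis
      by (simp add: visits_Suc_shift prod.shift_bounds_Suc_ivl choices_rec[of b] del: prod.op_ivl_Suc)
  qed (simp add: visits_Suc_shift choices_rec[of b])
  then show ?case
    using prob_cylinder_Suc[of b l n] Suc.IH[OF ne, of ?l] le Suc.prems(1)[of 1]
    by (simp add: prod.lessThan_Suc_shift funpow_Suc_right shift_def del: funpow.simps prod.lessThan_Suc)
qed

end

section \<open>Local dimension\<close>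

text \<open>Distances between distinct points are powers of \<open>1 / gm\<close>, so on this
  half-open range of radii the ball only tests whether the first disagreement comes after index
  \<open>n\<close>.\<close>

lemma mball_rho:
  assumes z: "z \<in> UNIV \<times> {0..gm}" and r: "(1 / gm) ^ Suc n < r" "r \<le> (1 / gm) ^ n"
  shows "Metric_space.mball (UNIV \<times> {0..gm}) \<rho> z r =
    {z' \<in> UNIV \<times> {0..gm}. \<forall>i\<le>n. \<alpha> z' i = \<alpha> z i \<and> fst z' i = fst z i}"
proof -
  have "\<rho> z z' < r \<longleftrightarrow> (\<forall>i\<le>n. \<alpha> z' i = \<alpha> z i \<and> fst z' i = fst z i)"
    if z': "z' \<in> UNIV \<times> {0..gm}" for z'
  proof (cases "z = z'")
    case True
    have "0 < (1 / gm) ^ Suc n" by (intro zero_less_power) simp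
    with r(1) have "0 < r" by linarith
    with True show ?thesis by (simp add: \<rho>_def)
  next
    case False
    define P where "P k \<longleftrightarrow> fst z k \<noteq> fst z' k \<or> \<alpha> z k \<noteq> \<alpha> z' k" for k
    have "\<exists>k. P k" using coding_separates[OF z z'] False by (auto simp: P_def fun_eq_iff)
    then have L: "P (Least P)" by (rule LeastI_ex)
    have rho: "\<rho> z z' = (1 / gm) ^ Least P" using False by (simp add: \<rho>_def P_def[abs_def])
    have "\<rho> z z' < r \<longleftrightarrow> n < Least P"
    proof
      show "n < Least P" if "\<rho> z z' < r"
      proof (rule ccontr)
        assume "\<not> n < Least P"
        then have "(1 / gm) ^ n \<le> (1 / gm) ^ Least P"
          using gm_gt_1 by (intro power_decreasing) auto
        with that r(2) show False unfolding rho by linarith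
      qed
      show "\<rho> z z' < r" if "n < Least P"
      proof -
        have "(1 / gm) ^ Least P \<le> (1 / gm) ^ Suc n"
          using gm_gt_1 that by (intro power_decreasing) auto
        with r(1) show ?thesis unfolding rho by linarith
      qed
    qed
    also have "\<dots> \<longleftrightarrow> (\<forall>i\<le>n. \<not> P i)"
      using L not_less_Least[of _ P] by (metis le_less_trans not_le)
    finally show ?thesis by (auto simp: P_def)
  qed
  then show ?thesis using z by (auto simp: Metric_space.in_mball[OF Metric_space_rho])
qed

text \<open>Covers the radii beyond 1 in the positivity part of
  \<open>has_local_dim\<close>.\<close>

lemma mball_rho_eq_space:
  assumes z: "z \<in> UNIV \<times> {0..gm}" and r: "r > 1"
  shows "Metric_space.mball (UNIV \<times> {0..gm}) \<rho> z r = UNIV \<times> {0..gm}"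
proof -
  have "\<rho> z z' \<le> 1" for z' using gm_gt_1 by (simp add: \<rho>_def power_le_one)
  then have "\<rho> z z' < r" for z' using r by (rule le_less_trans)
  then show ?thesis using z by (auto simp: Metric_space.in_mball[OF Metric_space_rho])
qed

text \<open>For \<open>0 < r\<close> and \<open>r \<le> 1\<close>, the index \<open>n\<close> of the
  range of radii in \<open>mball_rho\<close> that contains \<open>r\<close>.\<close>

definition scale :: "real \<Rightarrow> nat" where
  "scale r = nat \<lfloor>- ln r / ln gm\<rfloor>"

lemma ln_gm_pos: "ln gm > 0"
  using gm_gt_1 by simp

lemma scale_bounds:
  assumes "0 < r" "r \<le> 1"
  shows "(1 / gm) ^ Suc (scale r) < r" "r \<le> (1 / gm) ^ scale r"
proof -
  define t where "t = - ln r / ln gm"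
  have "t \<ge> 0"
    unfolding t_def using assms ln_gm_pos by (intro divide_nonneg_nonneg) auto
  then have t: "real (scale r) \<le> t" "t < real (Suc (scale r))"
    unfolding scale_def t_def[symmetric] by linarith+
  have pow: "(1 / gm) ^ k = exp (- (real k * ln gm))" for k
    using gm_pos by (simp add: exp_minus exp_of_nat_mult power_one_over inverse_eq_divide)
  have r: "r = exp (- (t * ln gm))" using assms ln_gm_pos by (simp add: t_def)
  show "(1 / gm) ^ Suc (scale r) < r"
    unfolding pow by (subst (2) r) (use t ln_gm_pos in \<open>simp only: exp_less_cancel_iff neg_less_iff_less mult_less_cancel_right_pos\<close>)
  show "r \<le> (1 / gm) ^ scale r"
    unfolding pow by (subst r) (use t ln_gm_pos in \<open>simp only: exp_le_cancel_iff neg_le_iff_le mult_le_cancel_right_pos\<close>)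
qed

text \<open>\<open>scale r\<close> is the integer part of \<open>- ln r / ln gm\<close>, which tends
  to infinity, so their quotient tends to 1 and dividing by \<open>ln r\<close> amounts to dividing
  by the scale times \<open>- ln gm\<close>.\<close>

lemma tendsto_along_scale:
  fixes x :: "nat \<Rightarrow> real"
  assumes x: "(\<lambda>n. x n / real n) \<longlonglongrightarrow> L"
  shows "((\<lambda>r. x (scale r) / ln r) \<longlongrightarrow> - L / ln gm) (at_right 0)"
proof -
  define t where "t r = - ln r / ln gm" for r
  have "filterlim (\<lambda>r::real. - ln r) at_top (at_right 0)"
    using ln_at_0 by (simp add: filterlim_uminus_at_bot)
  then have "filterlim (\<lambda>r. (1 / ln gm) * - ln r) at_top (at_right 0)"
    using ln_gm_pos by (intro filterlim_tendsto_pos_mult_at_top[OF tendsto_const]) auto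
  then have t: "filterlim t at_top (at_right 0)" by (simp add: t_def[abs_def])
  have scale_t: "scale r = nat \<lfloor>t r\<rfloor>" for r by (simp add: scale_def t_def)
  have lim: "filterlim scale sequentially (at_right 0)"
    unfolding scale_t[abs_def]
    by (intro filterlim_compose[OF filterlim_nat_sequentially] filterlim_compose[OF filterlim_floor_sequentially] t)
  have "((\<lambda>r. real (scale r) / t r) \<longlongrightarrow> 1) (at_right 0)"
  proof (rule tendsto_sandwich)
    have pos: "\<forall>\<^sub>F r in at_right 0. t r > 0" using t by (simp add: filterlim_at_top_dense)
    show "\<forall>\<^sub>F r in at_right 0. 1 - 1 / t r \<le> real (scale r) / t r"
      using pos
    proof eventually_elim
      case (elim r)
      then have "t r - 1 \<le> real (scale r)" unfolding scale_t by linarith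
      then have "(t r - 1) / t r \<le> real (scale r) / t r" using elim by (intro divide_right_mono) auto
      then show ?case using elim by (simp add: diff_divide_distrib)
    qed
    show "\<forall>\<^sub>F r in at_right 0. real (scale r) / t r \<le> 1"
      using pos
    proof eventually_elim
      case (elim r)
      then have "real (scale r) \<le> t r" unfolding scale_t by linarith
      then show ?case using elim by simp
    qed
    have "((\<lambda>r. 1 / t r) \<longlongrightarrow> 0) (at_right 0)"
      by (rule tendsto_divide_0[OF tendsto_const filterlim_at_top_imp_at_infinity[OF t]])
    then show "((\<lambda>r. 1 - 1 / t r) \<longlongrightarrow> 1) (at_right 0)"
      using tendsto_diff[OF tendsto_const[of 1]] by force
  qed simp
  then have "((\<lambda>r. (x (scale r) / real (scale r)) * (real (scale r) / t r) * (- 1 / ln gm)) \<longlongrightarrow> L * 1 * (- 1 / ln gm)) (at_right 0)"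
    by (intro tendsto_mult tendsto_const filterlim_compose[OF x lim])
  then have "((\<lambda>r. (x (scale r) / real (scale r)) * (real (scale r) / t r) * (- 1 / ln gm)) \<longlongrightarrow> - L / ln gm) (at_right 0)"
    by simp
  then show ?thesis
  proof (rule Lim_transform_eventually)
    have "\<forall>\<^sub>F r in at_right 0. scale r > 0"
      using filterlim_at_top[THEN iffD1, rule_format, OF lim, of 1] by eventually_elim simp
    then show "\<forall>\<^sub>F r in at_right 0. (x (scale r) / real (scale r)) * (real (scale r) / t r) * (- 1 / ln gm) = x (scale r) / ln r"
      by eventually_elim (use ln_gm_pos in \<open>simp add: t_def\<close>)
  qed
qed

text \<open>Any function of a bit is affine in the bit; applied below to the logarithms of the
  weights.\<close>

lemma affine_average:
  fixes a d \<mu> :: real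
  assumes "(\<lambda>n. (\<Sum>i<n. of_bool (x i) - \<mu>) / real n) \<longlonglongrightarrow> 0"
  shows "(\<lambda>n. (\<Sum>i<n. if x i then a else d) / real n) \<longlonglongrightarrow> \<mu> * a + (1 - \<mu>) * d"
proof -
  have "(\<lambda>n. (a - d) * ((\<Sum>i<n. of_bool (x i) - \<mu>) / real n) + (\<mu> * a + (1 - \<mu>) * d)) \<longlonglongrightarrow>
      (a - d) * 0 + (\<mu> * a + (1 - \<mu>) * d)"
    by (intro tendsto_intros assms)
  then have "(\<lambda>n. (a - d) * ((\<Sum>i<n. of_bool (x i) - \<mu>) / real n) + (\<mu> * a + (1 - \<mu>) * d)) \<longlonglongrightarrow> \<mu> * a + (1 - \<mu>) * d"
    by simp
  then show ?thesis
  proof (rule Lim_transform_eventually)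
    have "(\<Sum>i<n. if x i then a else d) = (a - d) * (\<Sum>i<n. of_bool (x i) - \<mu>) + real n * (\<mu> * a + (1 - \<mu>) * d)" for n
      by (induction n) (auto simp: algebra_simps)
    then show "\<forall>\<^sub>F n in sequentially. (a - d) * ((\<Sum>i<n. of_bool (x i) - \<mu>) / real n) + (\<mu> * a + (1 - \<mu>) * d) =
        (\<Sum>i<n. if x i then a else d) / real n"
      by (intro eventually_mono[OF eventually_gt_at_top[of 0]]) (simp add: add_divide_distrib)
  qed
qed

section \<open>Transfer to \<nu> and computation of the exponent\<close>

context golden_mean_measure
begin

text \<open>Finitely many visits would have frequency 0, but the frequency is almost surely
  \<open>q R_s > 0\<close>.\<close>

lemma AE_\<psi>_in_Z: "AE b in m p. \<psi> b \<in> Z"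
  using visits_strong_law
proof eventually_elim
  case (elim b)
  have "infinite {n. creg ((shift ^^ n) b) = R_s}"
  proof
    assume fin: "finite {n. creg ((shift ^^ n) b) = R_s}"
    let ?c = "real (card {n. creg ((shift ^^ n) b) = R_s})"
    have "(\<lambda>n. real (visits b n) / real n) \<longlonglongrightarrow> 0"
    proof (rule Lim_null_comparison[OF always_eventually lim_const_over_n])
      show "\<forall>n. norm (real (visits b n) / real n) \<le> ?c / real n"
        unfolding visits_def using fin by (auto intro!: divide_right_mono card_mono)
    qed
    with elim q_pos[of R_s] show False using LIMSEQ_unique by fastforce
  qed
  then show ?case by (simp add: \<psi>_in_Z_iff)
qed

lemma measurable_\<psi>_m [measurable]: "\<psi> \<in> measurable (m p) phase_space"
  by measurable

text \<open>By \<open>\<phi>_image\<close> the set function defining \<nu> differs from the image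
  measure only through sequences that \<psi> maps outside \<open>Z\<close>, a null set.\<close>

lemma \<nu>_eq_distr: "\<nu> p = distr (m p) phase_space \<psi>"
  unfolding \<nu>_def distr_def
proof (rule measure_of_eq[OF sets.space_closed])
  fix A assume "A \<in> sigma_sets (space phase_space) (sets phase_space)"
  then have A[measurable]: "A \<in> sets phase_space" by (simp add: sets.sigma_sets_eq)
  have "{b. \<psi> b \<in> A \<inter> Z} = \<psi> -` (A \<inter> Z) \<inter> space (m p)" by auto
  then have 1: "{b. \<psi> b \<in> A \<inter> Z} \<in> sets (m p)"
    by (simp only: measurable_sets[OF measurable_\<psi>_m] sets.Int A Z_sets)
  show "emeasure (m p) (\<phi> ` (A \<inter> Z)) = emeasure (m p) (\<psi> -` A \<inter> space (m p))"
  proof (rule emeasure_eq_AE)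
    show "AE b in m p. b \<in> \<phi> ` (A \<inter> Z) \<longleftrightarrow> b \<in> \<psi> -` A \<inter> space (m p)"
      unfolding \<phi>_image using AE_\<psi>_in_Z by eventually_elim simp
    show "\<phi> ` (A \<inter> Z) \<in> sets (m p)" unfolding \<phi>_image using 1 by simp
  qed measurable
qed

lemma measure_\<nu>: "A \<in> sets phase_space \<Longrightarrow> measure (\<nu> p) A = prob {b. \<psi> b \<in> A}"
  unfolding \<nu>_eq_distr by (subst measure_distr) (auto simp: vimage_def)

lemma measure_\<nu>_S: "measure (\<nu> p) (UNIV \<times> S) = q R_s"
proof -
  have "UNIV \<times> S = {z \<in> space phase_space. snd z \<in> S}"
  proof -
    have "S \<subseteq> {0..gm}" using gm_gt_1 by (auto simp: S_def intro: order_trans[of 0 "1 / gm"])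
    then show ?thesis by (auto simp: space_phase_space)
  qed
  also have "\<dots> \<in> sets phase_space" unfolding S_def by measurable
  finally have "measure (\<nu> p) (UNIV \<times> S) = prob {b. creg b = R_s}"
    by (simp add: measure_\<nu> \<psi>_in_S_iff del: mem_Sigma_iff)
  also have "\<dots> = cond R_s (\<lambda>_. 1)" by (simp add: cond_def expectation_of_bool)
  finally show ?thesis by (simp add: cond_const del: q.simps)
qed

text \<open>The ball prescribes indices 0 to \<open>n\<close> of both codings, hence
  \<open>Suc n\<close> choices.\<close>

lemma measure_\<nu>_mball:
  assumes "(1 / gm) ^ Suc n < r" "r \<le> (1 / gm) ^ n"
  shows "measure (\<nu> p) (Metric_space.mball (space (\<nu> p)) \<rho> (\<psi> b) r) = prob (cylinder n (Suc n) b)"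
proof -
  let ?B = "{z' \<in> space phase_space. \<forall>i\<le>n. \<alpha> z' i = \<alpha> (\<psi> b) i \<and> fst z' i = fst (\<psi> b) i}"
  have "Metric_space.mball (space (\<nu> p)) \<rho> (\<psi> b) r = ?B"
    unfolding space_nu mball_rho[OF \<psi>_in_space assms] space_phase_space ..
  moreover have "?B \<in> sets phase_space"
  proof -
    have [measurable]: "Measurable.pred phase_space (\<lambda>z. fst z i)" for i by measurable
    show ?thesis by measurable
  qed
  moreover have "{b'. \<psi> b' \<in> ?B} = cylinder n (Suc n) b"
    using \<psi>_in_space by (auto simp: cylinder_def \<alpha>_\<psi> fst_\<psi> space_phase_space less_Suc_eq_le)
  ultimately show ?thesis by (simp add: measure_\<nu>)
qed

lemma ln_prob_cylinder_asymptotics: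
  assumes b: "\<And>i. \<not> endpoint ((shift ^^ i) b)"
    and digits: "(\<lambda>n. (\<Sum>i<n. of_bool (b i) - (1 - p)) / real n) \<longlonglongrightarrow> 0"
    and choices: "(\<lambda>n. (\<Sum>j<n. of_bool (choices b j) - p) / real n) \<longlonglongrightarrow> 0"
    and visits: "(\<lambda>n. real (visits b n) / real n) \<longlonglongrightarrow> q R_s"
  shows "(\<lambda>n. ln (prob (cylinder n (Suc n) b)) / real n) \<longlonglongrightarrow> - (H p * (2 - q R_s))"
proof -
  define A where "A n = (\<Sum>i<n. ln (digit_weight (b i)))" for n
  define B where "B n = (\<Sum>j<n. ln (choice_weight (choices b j)))" for n
  define R where "R n = ln (q (creg ((shift ^^ n) b)))" for n
  have w: "digit_weight d > 0" "choice_weight d > 0" for d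
    using p_pos p_less_1 by (auto simp: digit_weight_def choice_weight_def)
  have ln: "ln (prob (cylinder n (Suc n) b)) = A n + R n + (B (Suc n) - B (visits b n))" for n
  proof -
    let ?P = "\<Prod>i<n. digit_weight (b i)" and ?C = "\<Prod>j\<in>{visits b n..<Suc n}. choice_weight (choices b j)"
    have "visits b n \<le> Suc n" using visits_le[of b n] by simp
    then have "B (visits b n) + (\<Sum>j\<in>{visits b n..<Suc n}. ln (choice_weight (choices b j))) = B (Suc n)"
      unfolding B_def lessThan_atLeast0 by (intro sum.atLeastLessThan_concat) auto
    then have B: "(\<Sum>j\<in>{visits b n..<Suc n}. ln (choice_weight (choices b j))) = B (Suc n) - B (visits b n)"
      by (simp only: eq_diff_eq add.commute)
    have P: "ln ?P = A n" and C: "ln ?C = (\<Sum>j\<in>{visits b n..<Suc n}. ln (choice_weight (choices b j)))"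
      unfolding A_def by (intro ln_prod w[THEN less_imp_neq, symmetric] finite_lessThan finite_atLeastLessThan)+
    have PC: "ln (?P * q (creg ((shift ^^ n) b)) * ?C) = ln ?P + R n + ln ?C"
    proof -
      have "?P > 0" "?C > 0" by (intro prod_pos ballI w)+
      then show ?thesis
        unfolding R_def using q_pos[of "creg ((shift ^^ n) b)"] by (simp only: ln_mult_pos mult_pos_pos)
    qed
    have "prob (cylinder n (Suc n) b) = ?P * q (creg ((shift ^^ n) b)) * ?C"
      by (intro prob_cylinder b) fact
    then show ?thesis by (simp only: PC P C B)
  qed
  have A: "(\<lambda>n. A n / real n) \<longlonglongrightarrow> - H p"
    using affine_average[OF digits, of "ln (1 - p)" "ln p"]
    by (simp add: A_def digit_weight_def if_distrib[of ln] H_def algebra_simps)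
  have B: "(\<lambda>n. B n / real n) \<longlonglongrightarrow> - H p"
    using affine_average[OF choices, of "ln p" "ln (1 - p)"]
    by (simp add: B_def choice_weight_def if_distrib[of ln] H_def algebra_simps)
  have "(\<lambda>n. B (Suc n) / real (Suc n) * (1 + 1 / real n)) \<longlonglongrightarrow> - H p * (1 + 0)"
    by (intro tendsto_mult tendsto_add tendsto_const lim_const_over_n LIMSEQ_Suc[OF B])
  then have "(\<lambda>n. B (Suc n) / real (Suc n) * (1 + 1 / real n)) \<longlonglongrightarrow> - H p" by simp
  then have B_Suc: "(\<lambda>n. B (Suc n) / real n) \<longlonglongrightarrow> - H p"
    by (rule Lim_transform_eventually)
       (use eventually_gt_at_top[of 0] in \<open>eventually_elim; simp add: divide_simps add_ac\<close>)
  \<comment> \<open>Visits have positive frequency, so their number tends to infinity and the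
    averages of \<open>B\<close> may be evaluated along it.\<close>
  have "filterlim (\<lambda>n. real (visits b n) / real n * real n) at_top sequentially"
    by (rule filterlim_tendsto_pos_mult_at_top[OF visits q_pos filterlim_real_sequentially])
  then have "filterlim (\<lambda>n. real (visits b n)) at_top sequentially"
    by (rule filterlim_mono_eventually[OF _ order_refl order_refl])
       (use eventually_gt_at_top[of 0] in \<open>eventually_elim; simp\<close>)
  then have vis_top: "filterlim (visits b) sequentially sequentially"
    by (simp add: filterlim_sequentially_iff_filterlim_real)
  have "(\<lambda>n. B (visits b n) / real (visits b n) * (real (visits b n) / real n)) \<longlonglongrightarrow> - H p * q R_s"
    by (intro tendsto_mult visits filterlim_compose[OF B vis_top])
  moreover have "\<forall>\<^sub>F n in sequentially. visits b n > 0"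
    using filterlim_at_top[THEN iffD1, rule_format, OF vis_top, of 1] by eventually_elim simp
  then have "\<forall>\<^sub>F n in sequentially. B (visits b n) / real (visits b n) * (real (visits b n) / real n) = B (visits b n) / real n"
    by eventually_elim simp
  ultimately have B_visits: "(\<lambda>n. B (visits b n) / real n) \<longlonglongrightarrow> - H p * q R_s"
    by (rule Lim_transform_eventually)
  have R: "(\<lambda>n. R n / real n) \<longlonglongrightarrow> 0"
  proof (rule Lim_null_comparison[OF always_eventually lim_const_over_n])
    show "\<forall>n. norm (R n / real n) \<le> (\<bar>ln (q R_e0)\<bar> + \<bar>ln (q R_s)\<bar> + \<bar>ln (q R_e1)\<bar>) / real n"
    proof
      fix n
      have "\<bar>R n\<bar> \<le> \<bar>ln (q R_e0)\<bar> + \<bar>ln (q R_s)\<bar> + \<bar>ln (q R_e1)\<bar>"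
        unfolding R_def by (cases "creg ((shift ^^ n) b)") (simp_all del: q.simps)
      then show "norm (R n / real n) \<le> (\<bar>ln (q R_e0)\<bar> + \<bar>ln (q R_s)\<bar> + \<bar>ln (q R_e1)\<bar>) / real n"
        by (simp add: divide_right_mono del: q.simps)
    qed
  qed
  have "(\<lambda>n. A n / real n + R n / real n + (B (Suc n) / real n - B (visits b n) / real n)) \<longlonglongrightarrow>
      - H p + 0 + (- H p - (- H p * q R_s))"
    by (intro tendsto_intros A R B_Suc B_visits)
  moreover have "- H p + 0 + (- H p - (- H p * q R_s)) = - (H p * (2 - q R_s))"
    by (simp add: algebra_simps del: q.simps)
  ultimately show ?thesis unfolding ln by (simp add: add_divide_distrib diff_divide_distrib del: q.simps)
qed

lemma prob_cylinder_pos: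
  assumes "\<And>i. \<not> endpoint ((shift ^^ i) b)"
  shows "prob (cylinder n (Suc n) b) > 0"
proof -
  have "digit_weight d > 0" "choice_weight d > 0" for d
    using p_pos p_less_1 by (auto simp: digit_weight_def choice_weight_def)
  then show ?thesis
    using visits_le[of b n] by (subst prob_cylinder[OF assms]) (auto intro!: mult_pos_pos prod_pos q_pos)
qed

lemma has_local_dim_\<nu>:
  assumes b: "\<And>i. \<not> endpoint ((shift ^^ i) b)"
    and lim: "(\<lambda>n. ln (prob (cylinder n (Suc n) b)) / real n) \<longlonglongrightarrow> L"
  shows "has_local_dim (\<nu> p) \<rho> (\<psi> b) (- L / ln gm)"
  unfolding has_local_dim_def
proof (intro conjI allI impI)
  let ?ball = "Metric_space.mball (space (\<nu> p)) \<rho> (\<psi> b)"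
  have ball: "measure (\<nu> p) (?ball r) = prob (cylinder (scale r) (Suc (scale r)) b)" if "0 < r" "r \<le> 1" for r
    using scale_bounds[OF that] by (rule measure_\<nu>_mball)
  show "measure (\<nu> p) (?ball r) > 0" if "r > 0" for r
  proof (cases "r \<le> 1")
    case True
    then show ?thesis using ball[OF that] prob_cylinder_pos[OF b] by simp
  next
    case False
    interpret nu: prob_space "\<nu> p" unfolding \<nu>_eq_distr by (rule prob_space_distr) measurable
    have "?ball r = space (\<nu> p)"
      using False unfolding space_nu by (intro mball_rho_eq_space \<psi>_in_space) auto
    then show ?thesis using nu.prob_space by simp
  qed
  have "\<forall>\<^sub>F r in at_right (0::real). r \<in> {0<..<1}"
    by (rule eventually_at_right_real) simp
  then have "\<forall>\<^sub>F r in at_right 0. ln (prob (cylinder (scale r) (Suc (scale r)) b)) / ln r = ln (measure (\<nu> p) (?ball r)) / ln r"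
    by eventually_elim (simp add: ball)
  then show "((\<lambda>r. ln (measure (\<nu> p) (?ball r)) / ln r) \<longlongrightarrow> - L / ln gm) (at_right 0)"
    by (rule Lim_transform_eventually[OF tendsto_along_scale[OF lim]])
qed

text \<open>\<open>AE_distr_iff\<close> asks for a measurable predicate while \<open>P\<close> is
  arbitrary. The exceptional set is therefore enlarged to a measurable null set \<open>N\<close> of
  sequences, and its preimage under \<phi> within \<open>Z\<close> is used.\<close>

lemma AE_\<nu>I:
  assumes "AE b in m p. P (\<psi> b)"
  shows "AE z in \<nu> p. P z"
proof -
  from assms obtain N where N: "{b. \<not> P (\<psi> b)} \<subseteq> N" "emeasure (m p) N = 0" "N \<in> sets bitseq_space"
    by (auto elim!: AE_E)
  note N(3)[measurable]
  have "N \<in> null_sets (m p)" using N by auto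
  then have "AE b in m p. b \<notin> N" by (rule AE_not_in)
  with AE_\<psi>_in_Z have ae: "AE b in m p. \<psi> b \<in> Z \<and> \<phi> (\<psi> b) \<notin> N"
    by eventually_elim (simp add: \<phi>_\<psi>)
  have "AE z in \<nu> p. z \<in> Z \<and> \<phi> z \<notin> N"
    unfolding \<nu>_eq_distr by (subst AE_distr_iff) (use ae in measurable)
  then show ?thesis
  proof eventually_elim
    case (elim z)
    then have "P (\<psi> (\<phi> z))" using N(1) by auto
    then show ?case using elim by (simp add: \<psi>_\<phi>)
  qed
qed

end

theorem corollary5p3:
  fixes p :: real
  assumes "0 < p" and "p < 1"
  shows "(AE z in \<nu> p. has_local_dim (\<nu> p) \<rho> z
            (H p / ln gm * (2 - measure (\<nu> p) (UNIV \<times> S)))) \<and>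
         H p / ln gm * (2 - measure (\<nu> p) (UNIV \<times> S)) =
         H p / ln gm * (2 - p * (1 - p) / (p\<^sup>2 - p + 1))"
proof
  interpret golden_mean_measure p using assms by unfold_locales
  show "H p / ln gm * (2 - measure (\<nu> p) (UNIV \<times> S)) = H p / ln gm * (2 - p * (1 - p) / (p\<^sup>2 - p + 1))"
    by (simp add: measure_\<nu>_S c_def)
  \<comment> \<open>The double negation matches the form \<open>- L / ln gm\<close> of
    \<open>has_local_dim_\<nu>\<close>.\<close>
  have "AE b in m p. has_local_dim (\<nu> p) \<rho> (\<psi> b) (- (- (H p * (2 - q R_s))) / ln gm)"
    using AE_orbit_not_endpoint digits_strong_law choices_strong_law visits_strong_law
  proof eventually_elim
    case (elim b)
    then show ?case by (intro has_local_dim_\<nu> ln_prob_cylinder_asymptotics) auto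
  qed
  then show "AE z in \<nu> p. has_local_dim (\<nu> p) \<rho> z (H p / ln gm * (2 - measure (\<nu> p) (UNIV \<times> S)))"
    unfolding measure_\<nu>_S by (intro AE_\<nu>I) (simp del: q.simps)
qed

end
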